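(* Let $q$ be a nonzero complex number and $n\ge 1$. In the quantum matrix algebra $M_q(2n+1)$, the quantum determinant of order $2n+1$ is a quantum Pfaffian of order $n+1$: $${\det}_q(a_{ij})_{1\le i,j\le 2n+1}=[1,2,\dots,2n,2n+1,2n+2],$$ where the right-hand side is the quantum Pfaffian built from the entries $$[i,j]=b'_{ij}=\sum_{m=1}^n\bigl(a_{i,2m-1}a_{j,2m}-q\,a_{j,2m-1}a_{i,2m}\bigr)\quad(1\le i<j\le 2n+1),$$ $$[i,2n+2]=a_{i,2n+1}\quad(1\le i\le 2n+1).$$
   Context: $M_q(N)$ is the unital associative complex algebra generated by $a_{ij}$, $1\le i,j\le N$, subject to the relations, for all $i<j$ and $k<l$: $a_{ik}a_{il}=qa_{il}a_{ik}$, $a_{ik}a_{jk}=qa_{jk}a_{ik}$, $a_{jk}a_{il}=a_{il}a_{jk}$, $a_{ik}a_{jl}-a_{jl}a_{ik}=(q-q^{-1})a_{il}a_{jk}$. The quantum determinant is ${\det}_q(a_{ij})_{1\le i,j\le N}=\sum_{\sigma\in S_N}(-q)^{l(\sigma)}a_{1,\sigma(1)}\cdots a_{N,\sigma(N)}$, with $l(\sigma)$ the number of inversions of $\sigma$. Quantum Pfaffian of order $p$: given elements $[i,j]$ ($1\le i<j\le 2p$) of an associative algebra, define $[s_1,\dots,s_{2t}]$ for $s_1<\cdots<s_{2t}$ in $\{1,\dots,2p\}$ inductively, for $t\ge2$, by $[s_1,\dots,s_{2t}]=\sum_{j=2}^{2t}(-q)^{j-2}[s_1,s_j]\,[s_2,\dots,\widehat{s_j},\dots,s_{2t}]$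 (hat means omitted). The quantum Pfaffian is $[1,2,\dots,2p]$. *)

theory Defs
  imports Complex_Main "HOL-Library.Poly_Mapping" "HOL-Combinatorics.Permutations"
    "HOL-Algebra.QuotRing" "HOL-Algebra.Module"
begin

text \<open>
  Noncommutative words, written additively so that the convolution product of
  \<^theory>\<open>HOL-Library.Poly_Mapping\<close> on finitely supported functions on words is the product of
  the free associative algebra.
\<close>

datatype 'a fword = FWord (letters: "'a list")

instantiation fword :: (type) monoid_add
begin

definition zero_fword :: "'a fword" where
  "0 = FWord []"

definition plus_fword :: "'a fword \<Rightarrow> 'a fword \<Rightarrow> 'a fword" where
  "u + v = FWord (letters u @ letters v)"

instance
  by standard (simp_all add: zero_fword_def plus_fword_def)

end

definition free_algebra :: "'a set \<Rightarrow> (complex, 'a fword \<Rightarrow>\<^sub>0 complex) module" where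
  "free_algebra X =
     \<lparr>carrier = {f. \<forall>w \<in> Poly_Mapping.keys f. set (letters w) \<subseteq> X},
      monoid.mult = (*), one = 1, zero = 0, add = (+),
      smult = (\<lambda>c f. Poly_Mapping.single 0 c * f)\<rparr>"

definition free_gen :: "'a \<Rightarrow> 'a fword \<Rightarrow>\<^sub>0 complex" where
  "free_gen x = Poly_Mapping.single (FWord [x]) 1"

text \<open>
  The quotient ring with its scalar multiplication. In a unital algebra every two-sided ring ideal
  is closed under scalars, so the ring-theoretic notion of ideal suffices.
\<close>

definition quotient_algebra ::
    "(complex, 'a) module \<Rightarrow> 'a set \<Rightarrow> (complex, 'a set) module" where
  "quotient_algebra A I =
     ring.extend (A Quot I) (module.fields (\<lambda>c C. \<Union>f\<in>C. I +>\<^bsub>A\<^esub> (c \<odot>\<^bsub>A\<^esub> f)))"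

text \<open>
  Differences of the two sides of the defining relations. A relation that involves only one row
  (only one column) is imposed for every row (every column), including the last one.
\<close>

definition qmat_relators :: "complex \<Rightarrow> nat \<Rightarrow> ((nat \<times> nat) fword \<Rightarrow>\<^sub>0 complex) set" where
  "qmat_relators q N =
     (let a = (\<lambda>i j. free_gen (i, j)); s = (\<lambda>c f. Poly_Mapping.single 0 c * f) in
        {a i k * a i l - s q (a i l * a i k) | i k l.
            i \<in> {1..N} \<and> k \<in> {1..N} \<and> l \<in> {1..N} \<and> k < l}
      \<union> {a i k * a j k - s q (a j k * a i k) | i j k.
            i \<in> {1..N} \<and> j \<in> {1..N} \<and> k \<in> {1..N} \<and> i < j}
      \<union> {a j k * a i l - a i l * a j k | i j k l.
            i \<in> {1..N} \<and> j \<in> {1..N} \<and> k \<in> {1..N} \<and> l \<in> {1..N} \<and> i < j \<and> k < l}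
      \<union> {a i k * a j l - a j l * a i k - s (q - inverse q) (a i l * a j k) | i j k l.
            i \<in> {1..N} \<and> j \<in> {1..N} \<and> k \<in> {1..N} \<and> l \<in> {1..N} \<and> i < j \<and> k < l})"

definition qmat_ideal :: "complex \<Rightarrow> nat \<Rightarrow> ((nat \<times> nat) fword \<Rightarrow>\<^sub>0 complex) set" where
  "qmat_ideal q N = Idl\<^bsub>free_algebra ({1..N} \<times> {1..N})\<^esub> (qmat_relators q N)"

definition qmat_algebra ::
    "complex \<Rightarrow> nat \<Rightarrow> (complex, ((nat \<times> nat) fword \<Rightarrow>\<^sub>0 complex) set) module" where
  "qmat_algebra q N = quotient_algebra (free_algebra ({1..N} \<times> {1..N})) (qmat_ideal q N)"

definition qmat_gen ::
    "complex \<Rightarrow> nat \<Rightarrow> nat \<Rightarrow> nat \<Rightarrow> ((nat \<times> nat) fword \<Rightarrow>\<^sub>0 complex) set" where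
  "qmat_gen q N i j = qmat_ideal q N +>\<^bsub>free_algebra ({1..N} \<times> {1..N})\<^esub> free_gen (i, j)"

definition inversion_number :: "nat \<Rightarrow> (nat \<Rightarrow> nat) \<Rightarrow> nat" where
  "inversion_number N \<sigma> = card {(i, j). 1 \<le> i \<and> i < j \<and> j \<le> N \<and> \<sigma> j < \<sigma> i}"

definition quantum_det ::
    "(complex, 'a) module \<Rightarrow> complex \<Rightarrow> nat \<Rightarrow> (nat \<Rightarrow> nat \<Rightarrow> 'a) \<Rightarrow> 'a" where
  "quantum_det A q N a =
     (\<Oplus>\<^bsub>A\<^esub>\<sigma>\<in>{\<sigma>. \<sigma> permutes {1..N}}.
        (- q) ^ inversion_number N \<sigma>
          \<odot>\<^bsub>A\<^esub> foldr (\<lambda>x y. x \<otimes>\<^bsub>A\<^esub> y) (map (\<lambda>i. a i (\<sigma> i)) [1..<N + 1]) \<one>\<^bsub>A\<^esub>)"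

text \<open>
  \<open>qpf_bracket A q e t s\<close> is \<open>[s\<^sub>1, \<dots>, s\<^sub>2\<^sub>t]\<close> for an increasing list \<open>s\<close> of length \<open>2 t\<close>, where
  \<open>[i, j] = e i j\<close> for \<open>i < j\<close>. List positions start at 0, so position \<open>j\<close> holds the mathematical
  \<open>s\<^sub>j\<^sub>+\<^sub>1\<close> and its coefficient is \<open>(-q)\<^sup>j\<^sup>-\<^sup>1\<close>. The recursion never reaches \<open>t = 0\<close> from \<open>t \<ge> 1\<close>.
\<close>

primrec qpf_bracket ::
    "(complex, 'a) module \<Rightarrow> complex \<Rightarrow> (nat \<Rightarrow> nat \<Rightarrow> 'a) \<Rightarrow> nat \<Rightarrow> nat list \<Rightarrow> 'a" where
  "qpf_bracket A q e 0 s = \<one>\<^bsub>A\<^esub>"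
| "qpf_bracket A q e (Suc t) s =
     (if t = 0 then e (s ! 0) (s ! 1)
      else \<Oplus>\<^bsub>A\<^esub>j\<in>{1..<length s}.
             (- q) ^ (j - 1)
               \<odot>\<^bsub>A\<^esub> (e (s ! 0) (s ! j) \<otimes>\<^bsub>A\<^esub> qpf_bracket A q e t (nths s (- {0, j}))))"

definition quantum_pfaffian ::
    "(complex, 'a) module \<Rightarrow> complex \<Rightarrow> nat \<Rightarrow> (nat \<Rightarrow> nat \<Rightarrow> 'a) \<Rightarrow> 'a" where
  "quantum_pfaffian A q p e = qpf_bracket A q e p [1..<2 * p + 1]"

definition pf_entry_b ::
    "(complex, 'a) module \<Rightarrow> complex \<Rightarrow> nat \<Rightarrow> (nat \<Rightarrow> nat \<Rightarrow> 'a) \<Rightarrow> nat \<Rightarrow> nat \<Rightarrow> 'a" where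
  "pf_entry_b A q n a i j =
     (\<Oplus>\<^bsub>A\<^esub>m\<in>{1..n}.
        (a i (2 * m - 1) \<otimes>\<^bsub>A\<^esub> a j (2 * m))
          \<ominus>\<^bsub>A\<^esub> (q \<odot>\<^bsub>A\<^esub> (a j (2 * m - 1) \<otimes>\<^bsub>A\<^esub> a i (2 * m))))"

end

theory Submission
  imports Defs "HOL-Combinatorics.Multiset_Permutations"
begin

text \<open>
  Let \<open>D S C\<close> be the quantum minor with rows \<open>S\<close> and columns \<open>C\<close>, expanded along its first row.
  Induction on \<open>S\<close> gives the expansion along an arbitrary column: the sum of
  \<open>(- q)\<^sup>j a (S\<^sub>j, l) D (S - S\<^sub>j) C\<close> over \<open>j\<close> vanishes for \<open>l \<in> C\<close>, and is
  \<open>(- q)\<^sup>r D S (C \<union> {l})\<close> for \<open>l \<notin> C\<close>, with \<open>r\<close> the number of elements of \<open>C\<close> below \<open>l\<close>.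
  Each \<open>b'\<^sub>i\<^sub>j\<close> is a sum of minors on the column pairs \<open>{2 m - 1, 2 m}\<close>. Hence, in the recursion of the
  Pfaffian, the column expansion annihilates a repeated pair, and the surviving terms make up the first
  row of a larger minor. So a bracket of length \<open>2 t\<close> is the sum of the minors on all unions of \<open>t\<close>
  pairs, and one ending in \<open>2 n + 2\<close> is the same sum with the column \<open>2 n + 1\<close> added and one pair
  less. For the full bracket only the union of all pairs remains.
\<close>

section \<open>Lists, ranks and column pairs\<close>

lemma nths_Cons_Suc: "nths (s # S) (- {Suc j}) = s # nths S (- {j})"
  by (simp add: nths_Cons Compl_eq Collect_conv_if)

lemma nths_Cons_0: "nths (s # S) (- {0}) = S"
  by (simp add: nths_Cons nths_all)

text \<open>Turns the double deletion in the Pfaffian recursion into a single deletion from the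
  tail, the shape used by the column expansion.\<close>

lemma nths_Cons_0_Suc: "nths (s # S) (- {0, Suc j}) = nths S (- {j})"
proof -
  have "{i. Suc i \<in> - {0, Suc j}} = - {j}" by auto
  then show ?thesis by (simp add: nths_Cons)
qed

lemma nths_remove_append:
  assumes "j < length S"
  shows "nths (S @ [x]) (- {j}) = nths S (- {j}) @ [x]"
  using assms by (simp add: nths_append)

lemma nths_remove_last: "nths (S @ [x]) (- {length S}) = S"
proof -
  have "nths S (- {length S}) = S" by (rule nths_all) auto
  then show ?thesis by (simp add: nths_append)
qed

lemma length_nths_remove:
  assumes "j < length S"
  shows "length (nths S (- {j})) = length S - 1"
proof -
  have "{i. i < length S \<and> i \<in> - {j}} = {..<length S} - {j}" by auto
  then show ?thesis using assms by (simp add: length_nths)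
qed

lemma sorted_wrt_nths: "sorted_wrt R S \<Longrightarrow> sorted_wrt R (nths S A)"
  by (induction S arbitrary: A) (auto simp: nths_Cons dest: in_set_nthsD)

text \<open>For a member of \<open>C\<close> this is its 0-based position in increasing order. It is
  also needed for \<open>c\<close> outside \<open>C\<close>, where it is the position that
  \<open>c\<close> takes once inserted.\<close>

definition rank :: "nat set \<Rightarrow> nat \<Rightarrow> nat" where
  "rank C c = card {d \<in> C. d < c}"

lemma rank_remove:
  assumes "finite C" "c \<in> C"
  shows "rank (C - {c}) l = (if c < l then rank C l - 1 else rank C l)"
proof -
  have "{d \<in> C - {c}. d < l} = {d \<in> C. d < l} - {c}" by auto
  then show ?thesis using assms by (auto simp: rank_def card_Diff_singleton_if)
qed

text \<open>Guards the truncated subtraction in \<open>rank_remove\<close>.\<close>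

lemma rank_pos: "finite C \<Longrightarrow> c \<in> C \<Longrightarrow> c < l \<Longrightarrow> 0 < rank C l"
  by (auto simp: rank_def card_gt_0_iff)

lemma rank_insert:
  assumes "finite C" "c \<notin> C"
  shows "rank (insert c C) l = (if c < l then Suc (rank C l) else rank C l)"
proof -
  have "{d \<in> insert c C. d < l} = (if c < l then insert c {d \<in> C. d < l} else {d \<in> C. d < l})" by auto
  then show ?thesis using assms by (auto simp: rank_def)
qed

text \<open>The rank is strictly increasing on \<open>C\<close>, and both sides have the same
  cardinality. Sums over the columns below \<open>l\<close> thereby become sums over an initial
  segment of the naturals.\<close>

lemma rank_bij: "finite C \<Longrightarrow> bij_betw (rank C) {c \<in> C. c < l} {..<rank C l}"
proof (rule bij_betw_imageI)
  assume f: "finite C"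
  have less: "rank C x < rank C y" if "x \<in> C" "x < y" for x y
    unfolding rank_def using that f by (intro psubset_card_mono) auto
  show inj: "inj_on (rank C) {c \<in> C. c < l}"
    by (rule inj_onI) (metis (no_types, lifting) mem_Collect_eq less nat_neq_iff)
  have "rank C ` {c \<in> C. c < l} \<subseteq> {..<rank C l}" using less by auto
  moreover have "card (rank C ` {c \<in> C. c < l}) = card {..<rank C l}"
    using inj by (simp add: card_image) (simp add: rank_def)
  ultimately show "rank C ` {c \<in> C. c < l} = {..<rank C l}"
    by (simp add: card_subset_eq)
qed

text \<open>The recursion mirrors the first-row expansion of a minor. Since the later letters enter
  as a set, the count is the number of inversions for distinct lists.\<close>

primrec list_inversions :: "nat list \<Rightarrow> nat" where
  "list_inversions [] = 0"
| "list_inversions (x # xs) = rank (set xs) x + list_inversions xs"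

text \<open>Inversions are split by their first position. Those starting at \<open>i\<close>
  correspond, by injectivity of \<open>f\<close>, to the later values below \<open>f i\<close>; the
  others are counted by the induction hypothesis.\<close>

lemma list_inversions_map:
  assumes "inj_on f {i..N}"
  shows "list_inversions (map f [i..<Suc N]) = card {(j, k). i \<le> j \<and> j < k \<and> k \<le> N \<and> f k < f j}"
  using assms
proof (induction "Suc N - i" arbitrary: i)
  case 0
  then have empty: "{(j, k). i \<le> j \<and> j < k \<and> k \<le> N \<and> f k < f j} = {}" by auto
  show ?case unfolding empty using 0 by simp
next
  case (Suc d)
  then have i: "i \<le> N" by simp
  let ?I = "\<lambda>i. {(j, k). i \<le> j \<and> j < k \<and> k \<le> N \<and> f k < f j}"
  let ?K = "{k. i < k \<and> k \<le> N \<and> f k < f i}"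
  have fin: "finite (?I (Suc i))"
    by (rule finite_subset[of _ "{..N} \<times> {..N}"]) auto
  have "?I i = Pair i ` ?K \<union> ?I (Suc i)"
    by (auto simp: Suc_le_eq image_iff)
  moreover have "Pair i ` ?K \<inter> ?I (Suc i) = {}" by auto
  ultimately have card: "card (?I i) = card ?K + card (?I (Suc i))"
    using fin by (simp add: card_Un_disjoint card_image inj_on_def)
  have "{y \<in> f ` {Suc i..N}. y < f i} = f ` ?K" by auto
  moreover have "inj_on f ?K" by (rule inj_on_subset[OF Suc.prems]) auto
  ultimately have "rank (f ` {Suc i..N}) (f i) = card ?K"
    unfolding rank_def by (simp add: card_image)
  moreover have "list_inversions (map f [Suc i..<Suc N]) = card (?I (Suc i))"
    using Suc by (intro Suc.hyps) (auto intro: inj_on_subset)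
  moreover have "[i..<Suc N] = i # [Suc i..<Suc N]"
    using i by (simp add: upt_conv_Cons)
  ultimately show ?case
    unfolding card by (simp add: atLeastLessThanSuc_atLeastAtMost del: upt_Suc)
qed

text \<open>A permutation fixes everything outside \<open>{1..N}\<close>, so its word determines it.
  Surjectivity follows by counting, as both sides have N! elements.\<close>

lemma bij_betw_permutations_lists:
  "bij_betw (\<lambda>\<sigma>. map \<sigma> [1..<Suc N]) {\<sigma>. \<sigma> permutes {1..N}} (permutations_of_set {1..N})"
proof (rule bij_betw_imageI)
  show inj: "inj_on (\<lambda>\<sigma>. map \<sigma> [1..<Suc N]) {\<sigma>. \<sigma> permutes {1..N}}"
  proof (rule inj_onI, rule ext)
    fix \<sigma> \<tau> :: "nat \<Rightarrow> nat" and x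
    assume *: "\<sigma> \<in> {\<sigma>. \<sigma> permutes {1..N}}" "\<tau> \<in> {\<sigma>. \<sigma> permutes {1..N}}"
      "map \<sigma> [1..<Suc N] = map \<tau> [1..<Suc N]"
    show "\<sigma> x = \<tau> x"
    proof (cases "x \<in> {1..N}")
      case True
      then show ?thesis using *(3) by (auto simp: map_eq_conv simp del: upt_Suc)
    qed (use * in \<open>simp add: permutes_not_in\<close>)
  qed
  have "(\<lambda>\<sigma>. map \<sigma> [1..<Suc N]) ` {\<sigma>. \<sigma> permutes {1..N}} \<subseteq> permutations_of_set {1..N}"
  proof
    fix xs assume "xs \<in> (\<lambda>\<sigma>. map \<sigma> [1..<Suc N]) ` {\<sigma>. \<sigma> permutes {1..N}}"
    then obtain \<sigma> where \<sigma>: "\<sigma> permutes {1..N}" "xs = map \<sigma> [1..<Suc N]" by auto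
    show "xs \<in> permutations_of_set {1..N}"
      using permutes_image[OF \<sigma>(1)] permutes_inj_on[OF \<sigma>(1)] unfolding \<sigma>(2)
      by (intro permutations_of_setI)
        (auto simp: distinct_map atLeastLessThanSuc_atLeastAtMost simp del: upt_Suc)
  qed
  moreover have "card ((\<lambda>\<sigma>. map \<sigma> [1..<Suc N]) ` {\<sigma>. \<sigma> permutes {1..N}}) = card (permutations_of_set {1..N})"
    using inj by (simp add: card_image card_permutations)
  ultimately show "(\<lambda>\<sigma>. map \<sigma> [1..<Suc N]) ` {\<sigma>. \<sigma> permutes {1..N}} = permutations_of_set {1..N}"
    by (simp add: card_subset_eq)
qed

text \<open>Index 0 would contribute the single column 0 (truncated subtraction), hence the conditions \<open>0 \<notin> M\<close>.\<close>

definition block_columns :: "nat set \<Rightarrow> nat set" where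
  "block_columns M = (\<Union>m\<in>M. {2 * m - 1, 2 * m})"

lemma block_columns_insert: "block_columns (insert m M) = insert (2 * m - 1) (insert (2 * m) (block_columns M))"
  by (auto simp: block_columns_def)

lemma finite_block_columns: "finite M \<Longrightarrow> finite (block_columns M)"
  by (simp add: block_columns_def)

lemma block_index_unique:
  "0 < m \<Longrightarrow> 0 < k \<Longrightarrow> c \<in> {2 * m - 1, 2 * m} \<Longrightarrow> c \<in> {2 * k - 1, 2 * k} \<Longrightarrow> m = (k::nat)"
  by auto

text \<open>Different pairs are disjoint, so a pair lies in the union either completely or not at
  all.\<close>

lemma mem_block_columns:
  assumes "0 \<notin> M" "0 < m" "c \<in> {2 * m - 1, 2 * m}"
  shows "c \<in> block_columns M \<longleftrightarrow> m \<in> M"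
proof -
  have "k = m" if "k \<in> M" "c \<in> {2 * k - 1, 2 * k}" for k
    using block_index_unique[OF _ assms(2) that(2) assms(3)] assms(1) that(1) by (cases "k = 0") auto
  then show ?thesis
    unfolding block_columns_def using assms(3) by blast
qed

lemma card_block_columns:
  assumes "finite M" "0 \<notin> M"
  shows "card (block_columns M) = 2 * card M"
  using assms
proof (induction M)
  case (insert m M)
  then have "0 < m" "0 \<notin> M" by auto
  then show ?case
    using insert mem_block_columns[of M m "2 * m"] mem_block_columns[of M m "2 * m - 1"]
    by (simp add: block_columns_insert card_insert_if finite_block_columns)
qed (simp add: block_columns_def)

lemma block_columns_all: "insert (2 * n + 1) (block_columns {1..n}) = {1..2 * n + 1}"
proof -
  have "c \<in> block_columns {1..n}" if "c \<in> {1..2 * n}" for c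
    using that unfolding block_columns_def
    \<comment> \<open>Column \<open>c\<close> belongs to the pair whose index is c/2 rounded
      up.\<close>
    by (intro UN_I[of "(c + 1) div 2"]) auto
  then show ?thesis by (fastforce simp: block_columns_def)
qed

section \<open>Sums over sets of column pairs\<close>

definition subsets :: "nat \<Rightarrow> nat \<Rightarrow> nat set set" where
  "subsets n t = {M. M \<subseteq> {1..n} \<and> card M = t}"

lemma subsetsD:
  assumes "M \<in> subsets n t"
  shows "finite M" "0 \<notin> M" "card M = t" "M \<subseteq> {1..n}"
  using assms finite_subset[of M "{1..n}"] by (auto simp: subsets_def)

lemma finite_subsets: "finite (subsets n t)"
  by (rule finite_subset[of _ "Pow {1..n}"]) (auto simp: subsets_def)

lemma subsets_0: "subsets n 0 = {{}}"
  using finite_subset[of _ "{1..n}"] by (auto simp: subsets_def)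

lemma subsets_self: "subsets n n = {{1..n}}"
  using card_subset_eq[of "{1..n}"] by (auto simp: subsets_def)

text \<open>A \<open>t\<close>-set together with a new element is the same as a set of size
  \<open>Suc t\<close> with a marked element. The zeros for \<open>m \<in> M\<close> stand for the
  repeated pairs that the column expansion annihilates.\<close>

lemma sum_pairs_subsets:
  "(\<Sum>m = 1..n. \<Sum>M\<in>subsets n t. if m \<in> M then 0 else g m (insert m M)) =
    (\<Sum>M\<in>subsets n (Suc t). \<Sum>m\<in>M. g m M :: 'b::comm_monoid_add)"
proof -
  have "(\<Sum>m = 1..n. \<Sum>M\<in>subsets n t. if m \<in> M then 0 else g m (insert m M)) =
    (\<Sum>m = 1..n. \<Sum>M\<in>{M \<in> subsets n t. m \<notin> M}. g m (insert m M))"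
    by (intro sum.cong refl sum.mono_neutral_cong_right) (auto simp: finite_subsets)
  also have "\<dots> = (\<Sum>(m, M)\<in>(SIGMA m:{1..n}. {M \<in> subsets n t. m \<notin> M}). g m (insert m M))"
    by (rule sum.Sigma) (auto simp: finite_subsets)
  also have "\<dots> = (\<Sum>(M, m)\<in>(SIGMA M:subsets n (Suc t). M). g m M)"
  proof (rule sum.reindex_bij_witness[of _ "\<lambda>(M, m). (m, M - {m})" "\<lambda>(m, M). (insert m M, m)"])
    fix x assume "x \<in> (SIGMA m:{1..n}. {M \<in> subsets n t. m \<notin> M})"
    then obtain m M where x: "x = (m, M)" "m \<in> {1..n}" "M \<in> subsets n t" "m \<notin> M" by auto
    show "(case case x of (m, M) \<Rightarrow> (insert m M, m) of (M, m) \<Rightarrow> (m, M - {m})) = x"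
      using x by auto
    show "(case x of (m, M) \<Rightarrow> (insert m M, m)) \<in> (SIGMA M:subsets n (Suc t). M)"
      using x subsetsD[OF x(3)] by (simp add: subsets_def)
    show "(case case x of (m, M) \<Rightarrow> (insert m M, m) of (M, m) \<Rightarrow> g m M) =
        (case x of (m, M) \<Rightarrow> g m (insert m M))"
      using x by simp
  next
    fix y assume "y \<in> (SIGMA M:subsets n (Suc t). M)"
    then obtain m M where y: "y = (M, m)" "M \<in> subsets n (Suc t)" "m \<in> M" by auto
    show "(case case y of (M, m) \<Rightarrow> (m, M - {m}) of (m, M) \<Rightarrow> (insert m M, m)) = y"
      using y by auto
    show "(case y of (M, m) \<Rightarrow> (m, M - {m})) \<in> (SIGMA m:{1..n}. {M \<in> subsets n t. m \<notin> M})"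
      using y subsetsD[OF y(2)] by (auto simp: subsets_def)
  qed
  also have "\<dots> = (\<Sum>M\<in>subsets n (Suc t). \<Sum>m\<in>M. g m M)"
    by (rule sum.Sigma[symmetric]) (auto simp: finite_subsets subsetsD(1))
  finally show ?thesis .
qed

lemma sum_block_columns:
  assumes "finite M" "0 \<notin> M"
  shows "(\<Sum>c\<in>block_columns M. g c) = (\<Sum>m\<in>M. \<Sum>c\<in>{2 * m - 1, 2 * m}. g c :: 'b::comm_monoid_add)"
  unfolding block_columns_def
proof (rule sum.UNION_disjoint)
  show "\<forall>i\<in>M. \<forall>j\<in>M. i \<noteq> j \<longrightarrow> {2 * i - 1, 2 * i} \<inter> {2 * j - 1, 2 * j} = {}"
    using block_index_unique assms(2) by (metis (no_types, lifting) disjoint_iff gr0I)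
qed (use assms in auto)

section \<open>Quantum minors\<close>

text \<open>The algebra is a whole type and the relations hold for all natural indices, so the
  combinatorics runs without membership or range conditions.\<close>

locale quantum_matrix = vector_space scale
  for scale :: "'k::field \<Rightarrow> 'a::{ring, monoid_mult} \<Rightarrow> 'a" (infixr \<open>*s\<close> 75) +
  fixes q :: 'k and a :: "nat \<Rightarrow> nat \<Rightarrow> 'a"
  assumes scale_mult_left: "(c *s x) * y = c *s (x * y)"
    and scale_mult_right: "x * (c *s y) = c *s (x * y)"
    and q_nonzero: "q \<noteq> 0"
    and column_rel: "i < j \<Longrightarrow> a i k * a j k = q *s (a j k * a i k)"
    and antidiagonal_rel: "i < j \<Longrightarrow> k < l \<Longrightarrow> a j k * a i l = a i l * a j k"
    and diagonal_rel: "i < j \<Longrightarrow> k < l \<Longrightarrow>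
      a i k * a j l - a j l * a i k = (q - inverse q) *s (a i l * a j k)"
begin

text \<open>Rows form a list because they fix the order of the factors; columns form a set and enter
  signs only through ranks. Minors with unequal numbers of rows and columns come out as 0, so the
  column expansion can be stated without a size condition.\<close>

primrec minor :: "nat list \<Rightarrow> nat set \<Rightarrow> 'a" where
  "minor [] C = (if C = {} then 1 else 0)"
| "minor (s # S) C = (\<Sum>c\<in>C. (- q) ^ rank C c *s (a s c * minor S (C - {c})))"

section \<open>Expansion of a minor along an arbitrary column\<close>

lemmas scale_simps = scale_mult_left scale_mult_right scale_sum_right scale_right_distrib
  scale_right_diff_distrib scale_scale

text \<open>After reindexing by rank the sum telescopes: the summand for \<open>k\<close> changes
  \<open>q ^ (2 * k)\<close> into \<open>q ^ (2 * k + 2)\<close>. It collects the corrections from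
  the diagonal relation over all columns below \<open>l\<close>.\<close>

lemma sum_rank_power:
  assumes "finite C"
  shows "1 - (q - inverse q) * (\<Sum>c | c \<in> C \<and> c < l. (- q) ^ Suc (2 * rank C c)) = q ^ (2 * rank C l)"
proof -
  have "(\<Sum>c | c \<in> C \<and> c < l. (- q) ^ Suc (2 * rank C c)) = (\<Sum>k<rank C l. (- q) ^ Suc (2 * k))"
    by (rule sum.reindex_bij_betw[OF rank_bij[OF assms]])
  moreover have "1 - (q - inverse q) * (\<Sum>k<r. (- q) ^ Suc (2 * k)) = q ^ (2 * r)" for r
  proof (induction r)
    case (Suc r)
    have "1 - (q - inverse q) * (\<Sum>k<Suc r. (- q) ^ Suc (2 * k)) =
      q ^ (2 * r) - (q - inverse q) * (- q) ^ Suc (2 * r)"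
      using Suc by (simp add: algebra_simps)
    also have "(- q) ^ Suc (2 * r) = - (q * q ^ (2 * r))"
      by (simp add: power_mult)
    also have "q ^ (2 * r) - (q - inverse q) * - (q * q ^ (2 * r)) = q ^ (2 * Suc r)"
      using q_nonzero by (simp add: field_simps)
    finally show ?case .
  qed simp
  ultimately show ?thesis by simp
qed

text \<open>Moves the entry of the upper row \<open>s\<close> to the front. For \<open>c < l\<close>
  the diagonal relation leaves a correction in which the columns \<open>c\<close> and
  \<open>l\<close> are exchanged; for \<open>c > l\<close> the entries commute.\<close>

lemma commute_entries:
  assumes "s < t"
  shows "a t l * a s c =
    (if c = l then inverse q *s (a s l * a t l)
     else a s c * a t l - (if c < l then (q - inverse q) *s (a s l * a t c) else 0))"
  using column_rel[OF assms, of l] diagonal_rel[OF assms, of c l] antidiagonal_rel[OF assms, of l c]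
    q_nonzero by (auto simp: algebra_simps)

text \<open>In every summand but the first, the minor is expanded along its first row
  \<open>s\<close> and \<open>a s c\<close> is moved to the front; the induction hypothesis then
  applies to the remaining rows. All corrections become multiples of
  \<open>a s l * minor S C\<close>, and their coefficients telescope.\<close>

lemma column_expansion:
  assumes "sorted_wrt (<) S" "finite C"
  shows "(\<Sum>j<length S. (- q) ^ j *s (a (S ! j) l * minor (nths S (- {j})) C)) =
    (if l \<in> C then 0 else (- q) ^ rank C l *s minor S (insert l C))"
  using assms
proof (induction S arbitrary: C l)
  case Nil
  then show ?case by simp
next
  case (Cons s S)
  let ?E = "\<lambda>l C. \<Sum>j<length S. (- q) ^ j *s (a (S ! j) l * minor (nths S (- {j})) C)"
  have srt: "sorted_wrt (<) S" and gt: "\<And>j. j < length S \<Longrightarrow> s < S ! j"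
    using Cons.prems by auto
  note IH = Cons.IH[OF srt]
  have fin: "finite C" by fact
  \<comment> \<open>The induction hypothesis in the case of a missing column: \<open>c\<close> is
    put back into \<open>C - {c}\<close>, and its rank is unaffected by its own removal.\<close>
  have E_del: "?E c (C - {c}) = (- q) ^ rank C c *s minor S C" if "c \<in> C" for c
    using IH[of "C - {c}" c] that fin by (simp add: insert_absorb rank_remove)
  \<comment> \<open>The total contribution of column \<open>c\<close> of row \<open>s\<close>. The
    exponent \<open>2 * rank C c\<close> joins the sign of the row expansion to the one produced by
    \<open>E_del\<close>.\<close>
  define T where "T c =
    (if c = l then (inverse q * (- q) ^ Suc (2 * rank C c)) *s (a s l * minor S C)
     else (- q) ^ Suc (rank C c) *s (a s c * ?E l (C - {c}))
       - (if c < l then ((q - inverse q) * (- q) ^ Suc (2 * rank C c)) *s (a s l * minor S C) else 0))"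
    for c
  have T: "(\<Sum>j<length S. (- q) ^ Suc j *s (a (S ! j) l *
      ((- q) ^ rank C c *s (a s c * minor (nths S (- {j})) (C - {c}))))) = T c"
    if c: "c \<in> C" for c
  proof -
    have "(\<Sum>j<length S. (- q) ^ Suc j *s (a (S ! j) l *
        ((- q) ^ rank C c *s (a s c * minor (nths S (- {j})) (C - {c}))))) =
      (\<Sum>j<length S. ((- q) ^ j * (- q) ^ Suc (rank C c)) *s
        ((a (S ! j) l * a s c) * minor (nths S (- {j})) (C - {c})))"
      by (simp add: scale_simps mult_ac)
    also have "\<dots> = (\<Sum>j<length S. ((- q) ^ j * (- q) ^ Suc (rank C c)) *s
        ((if c = l then inverse q *s (a s l * a (S ! j) l)
     else a s c * a (S ! j) l - (if c < l then (q - inverse q) *s (a s l * a (S ! j) c) else 0))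
       * minor (nths S (- {j})) (C - {c})))"
      by (rule sum.cong) (simp_all add: commute_entries[OF gt])
    also have "\<dots> = (if c = l then (inverse q * (- q) ^ Suc (rank C c)) *s (a s l * ?E c (C - {c}))
     else (- q) ^ Suc (rank C c) *s (a s c * ?E l (C - {c}))
       - (if c < l then ((q - inverse q) * (- q) ^ Suc (rank C c)) *s (a s l * ?E c (C - {c})) else 0))"
      by (simp add: scale_simps sum_distrib_left mult.assoc left_diff_distrib right_diff_distrib
          sum_subtractf mult_ac del: power_Suc)
    also have "\<dots> = T c"
      unfolding E_del[OF c] T_def
      by (simp add: scale_simps mult.assoc mult_2 power_add)
    finally show ?thesis .
  qed
  have "(\<Sum>j<length (s # S). (- q) ^ j *s (a ((s # S) ! j) l * minor (nths (s # S) (- {j})) C)) =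
    a s l * minor S C + (\<Sum>j<length S. (- q) ^ Suc j *s (a (S ! j) l * minor (s # nths S (- {j})) C))"
    by (simp only: length_Cons sum.lessThan_Suc_shift nths_Cons_0 nths_Cons_Suc) simp
  also have "(\<Sum>j<length S. (- q) ^ Suc j *s (a (S ! j) l * minor (s # nths S (- {j})) C)) =
    (\<Sum>c\<in>C. \<Sum>j<length S. (- q) ^ Suc j *s (a (S ! j) l *
      ((- q) ^ rank C c *s (a s c * minor (nths S (- {j})) (C - {c})))))"
    by (subst sum.swap) (simp add: sum_distrib_left scale_sum_right)
  also have "\<dots> = (\<Sum>c\<in>C. T c)"
    by (intro sum.cong refl T)
  finally have expand:
    "(\<Sum>j<length (s # S). (- q) ^ j *s (a ((s # S) ! j) l * minor (nths (s # S) (- {j})) C)) =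
      a s l * minor S C + (\<Sum>c\<in>C. T c)" .
  let ?P = "a s l * minor S C"
  define d where "d c = ((q - inverse q) * (- q) ^ Suc (2 * rank C c)) *s ?P" for c
  \<comment> \<open>The summand of the first row, reduced by all corrections \<open>d c\<close>, is
    a single power of \<open>q\<close> times \<open>?P\<close>.\<close>
  have low: "?P - (\<Sum>c | c \<in> C \<and> c < l. d c) =
      q ^ (2 * rank C l) *s ?P"
    unfolding sum_rank_power[OF fin, of l, symmetric]
    by (simp only: d_def scale_left_diff_distrib scale_one scale_sum_left sum_distrib_left)
  show ?case
  proof (cases "l \<in> C")
    case True
    \<comment> \<open>For \<open>c \<noteq> l\<close> the column \<open>l\<close> still belongs to
      \<open>C - {c}\<close>, so the inner expansion vanishes. What survives is the term
      \<open>c = l\<close> and the corrections, which together cancel \<open>?P\<close>.\<close>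
    have "T c = (if c = l then (inverse q * (- q) ^ Suc (2 * rank C l)) *s ?P else 0)
       - (if c < l then d c else 0)" if "c \<in> C" for c
      using IH[of "C - {c}" l] fin True by (auto simp: T_def d_def)
    then have "(\<Sum>c\<in>C. T c) = (inverse q * (- q) ^ Suc (2 * rank C l)) *s ?P
      - (\<Sum>c | c \<in> C \<and> c < l. d c)"
      using fin True by (simp add: sum_subtractf sum.inter_filter del: power_Suc)
    also have "inverse q * (- q) ^ Suc (2 * rank C l) = - (q ^ (2 * rank C l))"
      using q_nonzero by (simp add: power_mult)
    finally have "(\<Sum>c\<in>C. T c) = - (q ^ (2 * rank C l) *s ?P) - (\<Sum>c | c \<in> C \<and> c < l. d c)"
      by simp
    then have "?P + (\<Sum>c\<in>C. T c) = 0"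
      unfolding low[symmetric] by simp
    then show ?thesis unfolding expand using True by simp
  next
    case False
    let ?C = "insert l C"
    have "T c = (- q) ^ rank C l *s ((- q) ^ rank ?C c *s (a s c * minor S (?C - {c})))
       - (if c < l then d c else 0)" if c: "c \<in> C" for c
    proof -
      have ne: "c \<noteq> l" using c False by auto
      have "?E l (C - {c}) = (- q) ^ rank (C - {c}) l *s minor S (insert l (C - {c}))"
        using IH[of "C - {c}" l] fin False by auto
      moreover have "insert l (C - {c}) = ?C - {c}" using ne by auto
      \<comment> \<open>Exactly one of two shifts happens: for \<open>c < l\<close> removing
        \<open>c\<close> lowers the rank of \<open>l\<close>, and for \<open>c > l\<close> inserting
        \<open>l\<close> raises the rank of \<open>c\<close>.\<close>
      moreover have "Suc (rank C c) + rank (C - {c}) l = rank C l + rank ?C c"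
        using rank_remove[OF fin c, of l] rank_pos[OF fin c, of l] rank_insert[OF fin False, of c] ne
        by auto
      ultimately show ?thesis
        using ne by (simp add: T_def d_def scale_simps power_add[symmetric] del: power_Suc)
    qed
    then have "(\<Sum>c\<in>C. T c) = (- q) ^ rank C l *s (\<Sum>c\<in>C. (- q) ^ rank ?C c *s (a s c * minor S (?C - {c})))
      - (\<Sum>c | c \<in> C \<and> c < l. d c)"
      using fin by (simp add: sum_subtractf sum.inter_filter scale_sum_right del: power_Suc)
    then have "a s l * minor S C + (\<Sum>c\<in>C. T c) =
      (- q) ^ rank C l *s (\<Sum>c\<in>C. (- q) ^ rank ?C c *s (a s c * minor S (?C - {c}))) +
        q ^ (2 * rank C l) *s ?P"
      unfolding low[symmetric] by simp
    also have "\<dots> = (- q) ^ rank C l *s minor (s # S) ?C"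
    proof -
      \<comment> \<open>The leftover multiple of \<open>?P\<close> is the summand of column
        \<open>l\<close> that the sum over \<open>C\<close> lacks.\<close>
      have "minor (s # S) ?C = (- q) ^ rank C l *s ?P +
         (\<Sum>c\<in>C. (- q) ^ rank ?C c *s (a s c * minor S (?C - {c})))"
        using fin False rank_insert[OF fin False, of l] by simp
      moreover have "q ^ (2 * rank C l) = (- q) ^ rank C l * (- q) ^ rank C l"
        by (simp add: power_mult power2_eq_square flip: power_mult_distrib)
      ultimately show ?thesis by (simp add: scale_right_distrib)
    qed
    finally show ?thesis unfolding expand using False by simp
  qed
qed

text \<open>Permutations of \<open>C\<close> are grouped by their first letter \<open>c\<close>,
  whose inversions with the later letters number \<open>rank C c\<close>.\<close>

lemma minor_eq_sum_permutations:
  assumes "finite C" "length S = card C"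
  shows "minor S C = (\<Sum>xs\<in>permutations_of_set C.
    (- q) ^ list_inversions xs *s prod_list (map2 a S xs))"
  using assms
proof (induction S arbitrary: C)
  case Nil
  then show ?case by simp
next
  case (Cons s S)
  have ne: "C \<noteq> {}" using Cons.prems(2) by auto
  have IH: "minor S (C - {c}) = (\<Sum>xs\<in>permutations_of_set (C - {c}).
      (- q) ^ list_inversions xs *s prod_list (map2 a S xs))" if "c \<in> C" for c
    using Cons.prems that by (intro Cons.IH) auto
  have "minor (s # S) C = (\<Sum>c\<in>C. (- q) ^ rank C c *s (a s c *
      (\<Sum>xs\<in>permutations_of_set (C - {c}). (- q) ^ list_inversions xs *s prod_list (map2 a S xs))))"
    by (simp add: IH)
  also have "\<dots> = (\<Sum>c\<in>C. \<Sum>xs\<in>permutations_of_set (C - {c}).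
      (- q) ^ list_inversions (c # xs) *s prod_list (map2 a (s # S) (c # xs)))"
  proof (rule sum.cong[OF refl])
    fix c assume "c \<in> C"
    then have "rank (C - {c}) c = rank C c"
      using rank_remove[of C c c] Cons.prems by simp
    then show "(- q) ^ rank C c *s (a s c *
        (\<Sum>xs\<in>permutations_of_set (C - {c}). (- q) ^ list_inversions xs *s prod_list (map2 a S xs))) =
      (\<Sum>xs\<in>permutations_of_set (C - {c}).
        (- q) ^ list_inversions (c # xs) *s prod_list (map2 a (s # S) (c # xs)))"
      by (simp add: sum_distrib_left scale_simps power_add permutations_of_setD)
  qed
  also have "\<dots> = (\<Sum>c\<in>C. \<Sum>xs\<in>(#) c ` permutations_of_set (C - {c}).
      (- q) ^ list_inversions xs *s prod_list (map2 a (s # S) xs))"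
    by (simp add: sum.reindex)
  also have "\<dots> = (\<Sum>xs\<in>permutations_of_set C.
      (- q) ^ list_inversions xs *s prod_list (map2 a (s # S) xs))"
    unfolding permutations_of_set_nonempty[OF ne] using Cons.prems
    by (intro sum.UNION_disjoint[symmetric]) auto
  finally show ?case .
qed

lemma minor_eq_det:
  "minor [1..<Suc N] {1..N} = (\<Sum>\<sigma> | \<sigma> permutes {1..N}.
    (- q) ^ inversion_number N \<sigma> *s prod_list (map (\<lambda>i. a i (\<sigma> i)) [1..<Suc N]))"
proof -
  have "minor [1..<Suc N] {1..N} = (\<Sum>xs\<in>permutations_of_set {1..N}.
      (- q) ^ list_inversions xs *s prod_list (map2 a [1..<Suc N] xs))"
    by (rule minor_eq_sum_permutations) auto
  also have "\<dots> = (\<Sum>\<sigma> | \<sigma> permutes {1..N}. (- q) ^ list_inversions (map \<sigma> [1..<Suc N]) *s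
      prod_list (map2 a [1..<Suc N] (map \<sigma> [1..<Suc N])))"
    by (rule sum.reindex_bij_betw[OF bij_betw_permutations_lists, symmetric])
  also have "\<dots> = (\<Sum>\<sigma> | \<sigma> permutes {1..N}.
    (- q) ^ inversion_number N \<sigma> *s prod_list (map (\<lambda>i. a i (\<sigma> i)) [1..<Suc N]))"
  proof (intro sum.cong refl)
    fix \<sigma> assume "\<sigma> \<in> {\<sigma>. \<sigma> permutes {1..N}}"
    then have "inj_on \<sigma> {1..N}" using permutes_inj_on by blast
    then have "list_inversions (map \<sigma> [1..<Suc N]) = inversion_number N \<sigma>"
      by (simp only: list_inversions_map inversion_number_def)
    moreover have "map2 a [1..<Suc N] (map \<sigma> [1..<Suc N]) = map (\<lambda>i. a i (\<sigma> i)) [1..<Suc N]"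
      by (simp add: zip_map2 map_zip_map2 zip_same_conv_map del: upt_Suc)
    ultimately show "(- q) ^ list_inversions (map \<sigma> [1..<Suc N]) *s
        prod_list (map2 a [1..<Suc N] (map \<sigma> [1..<Suc N])) =
      (- q) ^ inversion_number N \<sigma> *s prod_list (map (\<lambda>i. a i (\<sigma> i)) [1..<Suc N])"
      by simp
  qed
  finally show ?thesis .
qed

section \<open>Pfaffians of minors on column pairs\<close>

definition block_entry :: "nat \<Rightarrow> nat \<Rightarrow> nat \<Rightarrow> 'a" where
  "block_entry n i j = (\<Sum>m = 1..n. a i (2 * m - 1) * a j (2 * m) - q *s (a j (2 * m - 1) * a i (2 * m)))"

text \<open>Starting from 1 at \<open>t = 0\<close> gives a simple induction base. For
  \<open>t = 1\<close> and a list of length 2 the sum has one term, the entry itself, in agreement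
  with \<open>qpf_bracket\<close>.\<close>

primrec bracket :: "(nat \<Rightarrow> nat \<Rightarrow> 'a) \<Rightarrow> nat \<Rightarrow> nat list \<Rightarrow> 'a" where
  "bracket e 0 S = 1"
| "bracket e (Suc t) S = (\<Sum>j\<in>{1..<length S}.
     (- q) ^ (j - 1) *s (e (S ! 0) (S ! j) * bracket e t (nths S (- {0, j}))))"

lemma bracket_Cons:
  "bracket e (Suc t) (s # S) =
    (\<Sum>j<length S. (- q) ^ j *s (e s (S ! j) * bracket e t (nths S (- {j}))))"
proof -
  have "{1..<length (s # S)} = Suc ` {..<length S}"
    by (simp add: lessThan_atLeast0 image_Suc_atLeastLessThan)
  then show ?thesis
    by (simp add: sum.reindex nths_Cons_0_Suc)
qed

text \<open>Entries on an antidiagonal commute, so both products can start with row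
  \<open>s\<close>, leaving expansions along the columns \<open>2 * m\<close> and
  \<open>2 * m - 1\<close>. Both vanish for a repeated pair. For a new pair the two columns are
  neighbours, and the factor \<open>- q\<close> of the entry is the relative sign of the second one.
  The set \<open>F\<close> makes room for the extra column \<open>2 * n + 1\<close>.\<close>

lemma block_expansion:
  assumes S: "sorted_wrt (<) S" and s: "\<forall>x\<in>set S. s < x" and m: "0 < m" and M: "finite M" "0 \<notin> M"
    and F: "finite F" "\<And>f. f \<in> F \<Longrightarrow> 2 * m < f"
  shows "(\<Sum>j<length S. (- q) ^ j *s
      ((a s (2 * m - 1) * a (S ! j) (2 * m) - q *s (a (S ! j) (2 * m - 1) * a s (2 * m)))
        * minor (nths S (- {j})) (block_columns M \<union> F))) =
    (if m \<in> M then 0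
     else \<Sum>c\<in>{2 * m - 1, 2 * m}. (- q) ^ rank (block_columns (insert m M) \<union> F) c *s
       (a s c * minor S (block_columns (insert m M) \<union> F - {c})))"
proof -
  let ?C = "block_columns M \<union> F" and ?C' = "block_columns (insert m M) \<union> F"
  let ?E = "\<lambda>l. \<Sum>j<length S. (- q) ^ j *s (a (S ! j) l * minor (nths S (- {j})) ?C)"
  have comm: "a (S ! j) (2 * m - 1) * a s (2 * m) = a s (2 * m) * a (S ! j) (2 * m - 1)"
    if "j < length S" for j
    using s that m by (intro antidiagonal_rel) auto
  have "(\<Sum>j<length S. (- q) ^ j *s
      ((a s (2 * m - 1) * a (S ! j) (2 * m) - q *s (a (S ! j) (2 * m - 1) * a s (2 * m)))
        * minor (nths S (- {j})) ?C)) =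
    (\<Sum>j<length S. (- q) ^ j *s
      ((a s (2 * m - 1) * a (S ! j) (2 * m) - q *s (a s (2 * m) * a (S ! j) (2 * m - 1)))
        * minor (nths S (- {j})) ?C))"
    by (intro sum.cong refl) (simp only: comm lessThan_iff)
  also have "\<dots> = a s (2 * m - 1) * ?E (2 * m) - q *s (a s (2 * m) * ?E (2 * m - 1))"
    by (simp add: scale_simps sum_distrib_left mult.assoc left_diff_distrib sum_subtractf mult_ac)
  finally have lhs: "(\<Sum>j<length S. (- q) ^ j *s
      ((a s (2 * m - 1) * a (S ! j) (2 * m) - q *s (a (S ! j) (2 * m - 1) * a s (2 * m)))
        * minor (nths S (- {j})) ?C)) = a s (2 * m - 1) * ?E (2 * m) - q *s (a s (2 * m) * ?E (2 * m - 1))" .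
  have fin: "finite ?C" using M F by (simp add: finite_block_columns)
  note E = column_expansion[OF S fin]
  show ?thesis
  proof (cases "m \<in> M")
    case True
    then show ?thesis unfolding lhs E using mem_block_columns[OF M(2) m] by (simp add: True)
  next
    case False
    have nin: "2 * m \<notin> ?C" "2 * m - 1 \<notin> ?C"
      using False mem_block_columns[OF M(2) m, of "2 * m"] mem_block_columns[OF M(2) m, of "2 * m - 1"] F(2)
      by force+
    have C': "?C' = insert (2 * m - 1) (insert (2 * m) ?C)"
      by (simp add: block_columns_insert)
    have ne: "2 * m - 1 \<noteq> 2 * m" using m by auto
    have del: "?C' - {2 * m - 1} = insert (2 * m) ?C" "?C' - {2 * m} = insert (2 * m - 1) ?C"
      unfolding C' using nin ne by auto
    obtain p where p: "2 * m - 1 = p" "2 * m = Suc p"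
      using m by (cases m) auto
    \<comment> \<open>The new columns are consecutive and absent from \<open>?C\<close>: their ranks
      agree there and differ by one in \<open>?C'\<close>.\<close>
    have "{d \<in> ?C'. d < 2 * m - 1} = {d \<in> ?C. d < 2 * m}"
      "{d \<in> ?C. d < 2 * m - 1} = {d \<in> ?C. d < 2 * m}"
      using nin unfolding C' p by (auto simp: less_Suc_eq)
    then have r1: "rank ?C' (2 * m - 1) = rank ?C (2 * m)"
      and r2: "rank ?C (2 * m - 1) = rank ?C (2 * m)"
      by (simp_all only: rank_def)
    have "{d \<in> ?C'. d < 2 * m} = insert (2 * m - 1) {d \<in> ?C. d < 2 * m}"
      unfolding C' p by auto
    then have r3: "rank ?C' (2 * m) = Suc (rank ?C (2 * m))"
      using fin nin by (simp add: rank_def)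
    show ?thesis
      unfolding lhs E using False nin ne by (simp add: del r1 r2 r3 scale_simps del: One_nat_def)
  qed
qed

text \<open>Summing \<open>block_expansion\<close> over all pairs and regrouping by the enlarged
  sets gives first-row expansions of minors, in which only the columns of \<open>F\<close> are still
  missing.\<close>

lemma bracket_step:
  assumes S: "sorted_wrt (<) S" and s: "\<forall>x\<in>set S. s < x"
    and F: "finite F" "\<forall>f\<in>F. 2 * n < f"
  shows "(\<Sum>j<length S. (- q) ^ j *s (block_entry n s (S ! j) *
      (\<Sum>M\<in>subsets n t. minor (nths S (- {j})) (block_columns M \<union> F)))) =
    (\<Sum>M\<in>subsets n (Suc t). \<Sum>c\<in>block_columns M.
      (- q) ^ rank (block_columns M \<union> F) c *s (a s c * minor S (block_columns M \<union> F - {c})))"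
proof -
  let ?b = "\<lambda>m j. a s (2 * m - 1) * a (S ! j) (2 * m) - q *s (a (S ! j) (2 * m - 1) * a s (2 * m))"
  let ?g = "\<lambda>m M. \<Sum>c\<in>{2 * m - 1, 2 * m}. (- q) ^ rank (block_columns M \<union> F) c *s
       (a s c * minor S (block_columns M \<union> F - {c}))"
  have "(\<Sum>j<length S. (- q) ^ j *s (block_entry n s (S ! j) *
      (\<Sum>M\<in>subsets n t. minor (nths S (- {j})) (block_columns M \<union> F)))) =
    (\<Sum>j<length S. \<Sum>m = 1..n. \<Sum>M\<in>subsets n t.
      (- q) ^ j *s (?b m j * minor (nths S (- {j})) (block_columns M \<union> F)))"
    unfolding block_entry_def by (simp only: sum_product scale_sum_right)
  also have "\<dots> = (\<Sum>m = 1..n. \<Sum>M\<in>subsets n t. \<Sum>j<length S.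
      (- q) ^ j *s (?b m j * minor (nths S (- {j})) (block_columns M \<union> F)))"
    by (subst sum.swap) (intro sum.cong refl sum.swap)
  also have "\<dots> = (\<Sum>m = 1..n. \<Sum>M\<in>subsets n t. if m \<in> M then 0 else ?g m (insert m M))"
  proof (intro sum.cong refl)
    fix m M assume "m \<in> {1..n}" "M \<in> subsets n t"
    then show "(\<Sum>j<length S. (- q) ^ j *s (?b m j * minor (nths S (- {j})) (block_columns M \<union> F))) =
        (if m \<in> M then 0 else ?g m (insert m M))"
      using F by (intro block_expansion[OF S s]) (auto simp: subsetsD)
  qed
  also have "\<dots> = (\<Sum>M\<in>subsets n (Suc t). \<Sum>m\<in>M. ?g m M)"
    by (rule sum_pairs_subsets)
  also have "\<dots> = (\<Sum>M\<in>subsets n (Suc t). \<Sum>c\<in>block_columns M.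
      (- q) ^ rank (block_columns M \<union> F) c *s (a s c * minor S (block_columns M \<union> F - {c})))"
    by (intro sum.cong refl sum_block_columns[symmetric]) (auto simp: subsetsD)
  finally show ?thesis .
qed

text \<open>With \<open>F\<close> empty, \<open>bracket_step\<close> already yields complete
  first-row expansions.\<close>

lemma bracket_even:
  assumes "sorted_wrt (<) S" "length S = 2 * t"
    and "\<And>i j. i \<in> set S \<Longrightarrow> j \<in> set S \<Longrightarrow> e i j = block_entry n i j"
  shows "bracket e t S = (\<Sum>M\<in>subsets n t. minor S (block_columns M))"
  using assms
proof (induction t arbitrary: S)
  case 0
  then show ?case by (simp add: subsets_0 block_columns_def)
next
  case (Suc t)
  then obtain s S' where S: "S = s # S'" by (cases S) auto
  have "bracket e t (nths S' (- {j})) = (\<Sum>M\<in>subsets n t. minor (nths S' (- {j})) (block_columns M))"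
    if "j < length S'" for j
    using Suc.prems that unfolding S
    by (intro Suc.IH) (auto simp: sorted_wrt_nths length_nths_remove dest: in_set_nthsD)
  then have "bracket e (Suc t) S = (\<Sum>j<length S'. (- q) ^ j *s (block_entry n s (S' ! j) *
      (\<Sum>M\<in>subsets n t. minor (nths S' (- {j})) (block_columns M \<union> {}))))"
    unfolding S bracket_Cons using Suc.prems(3) S by simp
  also have "\<dots> = (\<Sum>M\<in>subsets n (Suc t). minor S (block_columns M))"
    using Suc.prems by (subst bracket_step) (auto simp: S)
  finally show ?case .
qed

text \<open>In the recursion the first row \<open>s\<close> is paired either with another row, which
  leaves a shorter bracket ending in \<open>x\<close>, or with \<open>x\<close>, which leaves an
  even bracket. The second case supplies the column \<open>l\<close> missing from
  \<open>bracket_step\<close>.\<close>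

lemma bracket_odd:
  assumes "sorted_wrt (<) S" "length S = Suc (2 * t)"
    and "\<And>i j. i \<in> set S \<Longrightarrow> j \<in> set S \<Longrightarrow> e i j = block_entry n i j"
    and "\<And>i. i \<in> set S \<Longrightarrow> e i x = a i l" and l: "2 * n < l"
  shows "bracket e (Suc t) (S @ [x]) = (\<Sum>M\<in>subsets n t. minor S (insert l (block_columns M)))"
  using assms(1-4)
proof (induction t arbitrary: S)
  case 0
  then obtain s where "S = [s]" by (auto simp: length_Suc_conv)
  moreover have "rank {l} l = 0" by (auto simp: rank_def)
  ultimately show ?case using 0 by (simp add: bracket_Cons subsets_0 block_columns_def)
next
  case (Suc t)
  then obtain s S' where S: "S = s # S'" by (cases S) auto
  have len: "length S' = 2 * Suc t" using Suc.prems S by simp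
  have IH: "bracket e (Suc t) (nths S' (- {j}) @ [x]) =
      (\<Sum>M\<in>subsets n t. minor (nths S' (- {j})) (block_columns M \<union> {l}))"
    if "j < length S'" for j
    using Suc.prems that unfolding S
    by (subst Suc.IH) (auto simp: sorted_wrt_nths length_nths_remove dest: in_set_nthsD)
  have even: "bracket e (Suc t) S' = (\<Sum>M\<in>subsets n (Suc t). minor S' (block_columns M))"
    using Suc.prems S by (intro bracket_even) auto
  have last: "(- q) ^ rank (insert l (block_columns M)) l *s (a s l * minor S' (block_columns M - {l})) =
      (- q) ^ length S' *s (a s l * minor S' (block_columns M))"
    and nin: "l \<notin> block_columns M" if M: "M \<in> subsets n (Suc t)" for M
  proof -
    have lt: "c < l" if "c \<in> block_columns M" for c
      using that subsetsD(4)[OF M] l by (fastforce simp: block_columns_def)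
    then show nin: "l \<notin> block_columns M" by auto
    \<comment> \<open>Since \<open>l\<close> lies to the right of all pairs, its rank is the number
      of their columns, which equals the exponent of the last term of the recursion.\<close>
    have "{d \<in> block_columns M \<union> {l}. d < l} = block_columns M" using lt by auto
    then have "rank (block_columns M \<union> {l}) l = length S'"
      using card_block_columns[OF subsetsD(1,2)[OF M]] subsetsD(3)[OF M] len by (simp add: rank_def)
    then show "(- q) ^ rank (insert l (block_columns M)) l *s (a s l * minor S' (block_columns M - {l})) =
        (- q) ^ length S' *s (a s l * minor S' (block_columns M))"
      using nin by simp
  qed
  have "bracket e (Suc (Suc t)) (S @ [x]) =
    (\<Sum>j<length S'. (- q) ^ j *s (block_entry n s (S' ! j) *
      (\<Sum>M\<in>subsets n t. minor (nths S' (- {j})) (block_columns M \<union> {l})))) +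
    (- q) ^ length S' *s (a s l * (\<Sum>M\<in>subsets n (Suc t). minor S' (block_columns M)))"
    unfolding S append_Cons bracket_Cons[of _ "Suc t"] using Suc.prems(3,4) S
    by (simp add: nths_remove_append nths_remove_last IH even nth_append del: bracket.simps)
  also have "\<dots> = (\<Sum>M\<in>subsets n (Suc t). (\<Sum>c\<in>block_columns M.
      (- q) ^ rank (block_columns M \<union> {l}) c *s (a s c * minor S' (block_columns M \<union> {l} - {c}))) +
      (- q) ^ rank (block_columns M \<union> {l}) l *s (a s l * minor S' (block_columns M \<union> {l} - {l})))"
    using Suc.prems l S
    by (subst bracket_step) (auto simp: sum.distrib last sum_distrib_left scale_sum_right)
  also have "\<dots> = (\<Sum>M\<in>subsets n (Suc t). minor S (insert l (block_columns M)))"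
    by (intro sum.cong refl)
      (simp add: S nin subsetsD(1) finite_block_columns add.commute)
  finally show ?case .
qed

lemma bracket_eq_minor:
  assumes "\<And>i j. i \<in> {1..2 * n + 1} \<Longrightarrow> j \<in> {1..2 * n + 1} \<Longrightarrow> e i j = block_entry n i j"
    and "\<And>i. i \<in> {1..2 * n + 1} \<Longrightarrow> e i (2 * n + 2) = a i (2 * n + 1)"
  shows "bracket e (n + 1) [1..<2 * (n + 1) + 1] = minor [1..<2 * n + 2] {1..2 * n + 1}"
proof -
  have "bracket e (Suc n) ([1..<2 * n + 2] @ [2 * n + 2]) =
      (\<Sum>M\<in>subsets n n. minor [1..<2 * n + 2] (insert (2 * n + 1) (block_columns M)))"
    using assms by (intro bracket_odd) (auto simp del: upt_Suc)
  moreover have "[1..<2 * (n + 1) + 1] = [1..<2 * n + 2] @ [2 * n + 2]"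
    by simp
  ultimately show ?thesis by (simp add: subsets_self block_columns_all[simplified] del: upt_Suc bracket.simps)
qed

end

section \<open>Classes of noncommutative polynomials\<close>

text \<open>Rewriting \<open>1\<close> to \<open>Suc 0\<close> would turn \<open>{1..N}\<close>, inside the algebra, into a set no rule mentions.\<close>

context
  notes One_nat_def [simp del]
begin

lemma free_algebra_add:
  assumes "x \<in> carrier (free_algebra X)" "y \<in> carrier (free_algebra X)"
  shows "x + y \<in> carrier (free_algebra X)"
  using assms keys_add[of x y] unfolding free_algebra_def by auto

lemma free_algebra_mult:
  assumes "x \<in> carrier (free_algebra X)" "y \<in> carrier (free_algebra X)"
  shows "x * y \<in> carrier (free_algebra X)"
proof -
  have "set (letters w) \<subseteq> X" if w: "w \<in> Poly_Mapping.keys (x * y)" for w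
  proof -
    obtain u v where "w = u + v" "u \<in> Poly_Mapping.keys x" "v \<in> Poly_Mapping.keys y"
      using w keys_mult[of x y] by auto
    then show ?thesis using assms by (auto simp: free_algebra_def plus_fword_def)
  qed
  then show ?thesis by (simp add: free_algebra_def)
qed

lemma free_algebra_uminus: "x \<in> carrier (free_algebra X) \<Longrightarrow> - x \<in> carrier (free_algebra X)"
  by (simp add: free_algebra_def)

lemma free_algebra_one: "1 \<in> carrier (free_algebra X)"
  by (simp add: free_algebra_def zero_fword_def)

lemma free_algebra_zero: "0 \<in> carrier (free_algebra X)"
  by (simp add: free_algebra_def)

lemma free_algebra_simps:
  "add (free_algebra X) = (+)" "monoid.mult (free_algebra X) = (*)"
  "one (free_algebra X) = 1" "zero (free_algebra X) = 0"
  "smult (free_algebra X) = (\<lambda>c f. Poly_Mapping.single 0 c * f)"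
  by (simp_all add: free_algebra_def)

lemma ring_free_algebra: "ring (free_algebra X)"
proof (rule ringI)
  show "abelian_group (free_algebra X)"
  proof (rule abelian_groupI)
    fix x assume "x \<in> carrier (free_algebra X)"
    then show "\<exists>y\<in>carrier (free_algebra X). y \<oplus>\<^bsub>free_algebra X\<^esub> x = \<zero>\<^bsub>free_algebra X\<^esub>"
      by (intro bexI[of _ "- x"]) (simp_all add: free_algebra_simps free_algebra_uminus)
  qed (simp_all add: free_algebra_simps free_algebra_add free_algebra_zero ac_simps)
  show "Group.monoid (free_algebra X)"
    by (rule monoidI) (simp_all add: free_algebra_simps free_algebra_mult free_algebra_one mult.assoc)
qed (simp_all add: free_algebra_simps distrib_left distrib_right)

lemma scalar_in_free_algebra: "Poly_Mapping.single 0 c \<in> carrier (free_algebra X)"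
  by (auto simp: free_algebra_def zero_fword_def)

lemma free_gen_in_free_algebra: "x \<in> X \<Longrightarrow> free_gen x \<in> carrier (free_algebra X)"
  by (auto simp: free_algebra_def free_gen_def)

text \<open>Scalars live on the empty word \<open>0\<close>, which is neutral for concatenation; the
  induction adds one monomial at a time.\<close>

lemma scalar_central: "Poly_Mapping.single (0::'a fword) c * f = f * Poly_Mapping.single 0 (c::complex)"
proof (induction f rule: update_induct)
  case const
  then show ?case by simp
next
  case (update f a b)
  have "Poly_Mapping.update a b f = Poly_Mapping.single a b + f"
    using update(1) by (intro poly_mapping_eqI) (auto simp: lookup_add lookup_update lookup_single in_keys_iff when_def)
  then show ?case using update by (simp add: distrib_left distrib_right mult_single mult.commute)
qed

lemma free_algebra_minus:
  "x \<in> carrier (free_algebra X) \<Longrightarrow> y \<in> carrier (free_algebra X) \<Longrightarrow> x - y \<in> carrier (free_algebra X)"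
  using free_algebra_add[OF _ free_algebra_uminus] by force

section \<open>The ideal of relations and operations on classes\<close>

lemma qmat_relators_subset: "qmat_relators q N \<subseteq> carrier (free_algebra ({1..N} \<times> {1..N}))"
  unfolding qmat_relators_def Let_def
  by (auto intro!: free_algebra_minus free_algebra_mult scalar_in_free_algebra free_gen_in_free_algebra)

lemma ideal_qmat_ideal: "ideal (qmat_ideal q N) (free_algebra ({1..N} \<times> {1..N}))"
  unfolding qmat_ideal_def by (rule ring.genideal_ideal[OF ring_free_algebra qmat_relators_subset])

definition qmat_class :: "complex \<Rightarrow> nat \<Rightarrow> ((nat \<times> nat) fword \<Rightarrow>\<^sub>0 complex) \<Rightarrow> ((nat \<times> nat) fword \<Rightarrow>\<^sub>0 complex) set" where
  "qmat_class q N f = qmat_ideal q N +>\<^bsub>free_algebra ({1..N} \<times> {1..N})\<^esub> f"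

abbreviation qmat_words :: "nat \<Rightarrow> ((nat \<times> nat) fword \<Rightarrow>\<^sub>0 complex) set" where
  "qmat_words N \<equiv> carrier (free_algebra ({1..N} \<times> {1..N}))"

text \<open>Adding a scalar multiplication changes the record type, so the ring axioms of the
  quotient have to be carried over.\<close>

lemma ring_extend:
  assumes "ring R"
  shows "ring (ring.extend R m)"
proof -
  interpret ring R by fact
  have [simp]: "carrier (ring.extend R m) = carrier R" "monoid.mult (ring.extend R m) = monoid.mult R"
    "one (ring.extend R m) = \<one>\<^bsub>R\<^esub>" "zero (ring.extend R m) = \<zero>\<^bsub>R\<^esub>" "add (ring.extend R m) = add R"
    by (simp_all add: ring.defs)
  show ?thesis
  proof (rule ringI)
    show "abelian_group (ring.extend R m)"
    proof (rule abelian_groupI)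
      fix x assume "x \<in> carrier (ring.extend R m)"
      then show "\<exists>y\<in>carrier (ring.extend R m). y \<oplus>\<^bsub>ring.extend R m\<^esub> x = \<zero>\<^bsub>ring.extend R m\<^esub>"
        by (intro bexI[of _ "\<ominus>\<^bsub>R\<^esub> x"]) (simp_all add: l_neg)
    qed (simp_all add: a_ac)
    show "Group.monoid (ring.extend R m)"
      by (rule monoidI) (simp_all add: m_assoc)
  qed (simp_all add: l_distr r_distr)
qed

lemma ring_qmat_algebra: "ring (qmat_algebra q N)"
  unfolding qmat_algebra_def quotient_algebra_def
  by (rule ring_extend[OF ideal.quotient_is_ring[OF ideal_qmat_ideal]])

lemma carrier_qmat_algebra: "carrier (qmat_algebra q N) = qmat_class q N ` qmat_words N"
  by (auto simp: qmat_algebra_def quotient_algebra_def ring.defs FactRing_def A_RCOSETS_defs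
      a_r_coset_def qmat_class_def r_coset_def)

lemma qmat_algebra_ops:
  "add (qmat_algebra q N) = set_add (free_algebra ({1..N} \<times> {1..N}))"
  "monoid.mult (qmat_algebra q N) = rcoset_mult (free_algebra ({1..N} \<times> {1..N})) (qmat_ideal q N)"
  "one (qmat_algebra q N) = qmat_class q N 1"
  "zero (qmat_algebra q N) = qmat_ideal q N"
  "smult (qmat_algebra q N) = (\<lambda>c C. \<Union>f\<in>C. qmat_class q N (Poly_Mapping.single 0 c * f))"
  by (simp_all add: qmat_algebra_def quotient_algebra_def ring.defs module.defs FactRing_def
      qmat_class_def free_algebra_simps)

lemma qmat_class_add_mult:
  assumes "f \<in> qmat_words N" "g \<in> qmat_words N"
  shows "qmat_class q N f \<oplus>\<^bsub>qmat_algebra q N\<^esub> qmat_class q N g = qmat_class q N (f + g)"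
    and "qmat_class q N f \<otimes>\<^bsub>qmat_algebra q N\<^esub> qmat_class q N g = qmat_class q N (f * g)"
proof -
  interpret I: ideal "qmat_ideal q N" "free_algebra ({1..N} \<times> {1..N})" by (rule ideal_qmat_ideal)
  show "qmat_class q N f \<oplus>\<^bsub>qmat_algebra q N\<^esub> qmat_class q N g = qmat_class q N (f + g)"
    using I.a_rcos_sum[OF assms] by (simp add: qmat_algebra_ops qmat_class_def free_algebra_simps)
  show "qmat_class q N f \<otimes>\<^bsub>qmat_algebra q N\<^esub> qmat_class q N g = qmat_class q N (f * g)"
    using I.rcoset_mult_add[OF assms] by (simp add: qmat_algebra_ops qmat_class_def free_algebra_simps)
qed

lemma qmat_class_eqI:
  assumes "f \<in> qmat_words N" "g \<in> qmat_words N" "f - g \<in> qmat_ideal q N"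
  shows "qmat_class q N f = qmat_class q N g"
proof -
  interpret I: ideal "qmat_ideal q N" "free_algebra ({1..N} \<times> {1..N})" by (rule ideal_qmat_ideal)
  have "f = (f - g) + g" by simp
  then have "f \<in> qmat_ideal q N +>\<^bsub>free_algebra ({1..N} \<times> {1..N})\<^esub> g"
    using assms(3) unfolding a_r_coset_def' by (force simp: free_algebra_def)
  then show ?thesis
    unfolding qmat_class_def by (rule I.a_repr_independence[OF _ assms(2) I.a_subgroup, symmetric])
qed

text \<open>The scalar multiple is a union over all representatives. They all yield the same class
  because the ideal absorbs the scalar, and the union collapses because a class is nonempty.\<close>

lemma qmat_class_smult:
  assumes "f \<in> qmat_words N"
  shows "c \<odot>\<^bsub>qmat_algebra q N\<^esub> qmat_class q N f = qmat_class q N (Poly_Mapping.single 0 c * f)"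
proof -
  let ?s = "Poly_Mapping.single 0 c"
  interpret I: ideal "qmat_ideal q N" "free_algebra ({1..N} \<times> {1..N})" by (rule ideal_qmat_ideal)
  have "qmat_class q N (?s * h) = qmat_class q N (?s * f)" if h: "h \<in> qmat_class q N f" for h
  proof (rule qmat_class_eqI)
    from h obtain i where i: "i \<in> qmat_ideal q N" "h = i + f"
      by (auto simp: qmat_class_def a_r_coset_def' free_algebra_simps)
    then have "i \<in> qmat_words N" using I.a_subset by auto
    then show "?s * h \<in> qmat_words N"
      unfolding i(2) using assms by (intro free_algebra_mult free_algebra_add scalar_in_free_algebra)
    show "?s * f \<in> qmat_words N"
      using assms by (intro free_algebra_mult scalar_in_free_algebra)
    show "?s * h - ?s * f \<in> qmat_ideal q N"
      using I.I_l_closed[OF i(1) scalar_in_free_algebra[of c]]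
      by (simp add: i(2) distrib_left free_algebra_simps)
  qed
  then have "(\<Union>h\<in>qmat_class q N f. qmat_class q N (?s * h)) = (\<Union>h\<in>qmat_class q N f. qmat_class q N (?s * f))"
    by (rule SUP_cong[OF refl])
  also have "\<dots> = qmat_class q N (?s * f)"
    using I.a_rcos_self[OF assms] unfolding qmat_class_def by (subst UN_constant) auto
  finally show ?thesis unfolding qmat_algebra_ops .
qed

lemmas qmat_class_ops = qmat_class_add_mult qmat_class_smult

lemma qmat_algebra_smult_closed:
  "x \<in> carrier (qmat_algebra q N) \<Longrightarrow> c \<odot>\<^bsub>qmat_algebra q N\<^esub> x \<in> carrier (qmat_algebra q N)"
  by (auto simp: carrier_qmat_algebra qmat_class_ops free_algebra_mult scalar_in_free_algebra)

lemma qmat_algebra_smult: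
  assumes "x \<in> carrier (qmat_algebra q N)"
  shows "(c + d) \<odot>\<^bsub>qmat_algebra q N\<^esub> x =
      c \<odot>\<^bsub>qmat_algebra q N\<^esub> x \<oplus>\<^bsub>qmat_algebra q N\<^esub> d \<odot>\<^bsub>qmat_algebra q N\<^esub> x"
    and "c \<odot>\<^bsub>qmat_algebra q N\<^esub> (d \<odot>\<^bsub>qmat_algebra q N\<^esub> x) = (c * d) \<odot>\<^bsub>qmat_algebra q N\<^esub> x"
    and "1 \<odot>\<^bsub>qmat_algebra q N\<^esub> x = x"
proof -
  obtain f where f: "f \<in> qmat_words N" "x = qmat_class q N f"
    using assms by (auto simp: carrier_qmat_algebra)
  note simps = f qmat_class_ops free_algebra_mult scalar_in_free_algebra
  show "(c + d) \<odot>\<^bsub>qmat_algebra q N\<^esub> x =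
      c \<odot>\<^bsub>qmat_algebra q N\<^esub> x \<oplus>\<^bsub>qmat_algebra q N\<^esub> d \<odot>\<^bsub>qmat_algebra q N\<^esub> x"
    by (simp add: simps distrib_right single_add)
  show "c \<odot>\<^bsub>qmat_algebra q N\<^esub> (d \<odot>\<^bsub>qmat_algebra q N\<^esub> x) = (c * d) \<odot>\<^bsub>qmat_algebra q N\<^esub> x"
    by (simp add: simps mult_single flip: mult.assoc)
  show "1 \<odot>\<^bsub>qmat_algebra q N\<^esub> x = x"
    by (simp add: simps)
qed

lemma qmat_algebra_smult_bilinear:
  assumes "x \<in> carrier (qmat_algebra q N)" "y \<in> carrier (qmat_algebra q N)"
  shows "c \<odot>\<^bsub>qmat_algebra q N\<^esub> (x \<oplus>\<^bsub>qmat_algebra q N\<^esub> y) =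
      c \<odot>\<^bsub>qmat_algebra q N\<^esub> x \<oplus>\<^bsub>qmat_algebra q N\<^esub> c \<odot>\<^bsub>qmat_algebra q N\<^esub> y"
    and "(c \<odot>\<^bsub>qmat_algebra q N\<^esub> x) \<otimes>\<^bsub>qmat_algebra q N\<^esub> y =
      c \<odot>\<^bsub>qmat_algebra q N\<^esub> (x \<otimes>\<^bsub>qmat_algebra q N\<^esub> y)"
    and "x \<otimes>\<^bsub>qmat_algebra q N\<^esub> (c \<odot>\<^bsub>qmat_algebra q N\<^esub> y) =
      c \<odot>\<^bsub>qmat_algebra q N\<^esub> (x \<otimes>\<^bsub>qmat_algebra q N\<^esub> y)"
proof -
  obtain f where f: "f \<in> qmat_words N" "x = qmat_class q N f"
    using assms(1) by (auto simp: carrier_qmat_algebra)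
  obtain g where g: "g \<in> qmat_words N" "y = qmat_class q N g"
    using assms(2) by (auto simp: carrier_qmat_algebra)
  note simps = f g qmat_class_ops free_algebra_add free_algebra_mult scalar_in_free_algebra
  show "c \<odot>\<^bsub>qmat_algebra q N\<^esub> (x \<oplus>\<^bsub>qmat_algebra q N\<^esub> y) =
      c \<odot>\<^bsub>qmat_algebra q N\<^esub> x \<oplus>\<^bsub>qmat_algebra q N\<^esub> c \<odot>\<^bsub>qmat_algebra q N\<^esub> y"
    by (simp add: simps distrib_left)
  show "(c \<odot>\<^bsub>qmat_algebra q N\<^esub> x) \<otimes>\<^bsub>qmat_algebra q N\<^esub> y =
      c \<odot>\<^bsub>qmat_algebra q N\<^esub> (x \<otimes>\<^bsub>qmat_algebra q N\<^esub> y)"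
    by (simp add: simps mult.assoc)
  have "f * (Poly_Mapping.single 0 c * g) = Poly_Mapping.single 0 c * (f * g)"
    by (metis mult.assoc scalar_central)
  then show "x \<otimes>\<^bsub>qmat_algebra q N\<^esub> (c \<odot>\<^bsub>qmat_algebra q N\<^esub> y) =
      c \<odot>\<^bsub>qmat_algebra q N\<^esub> (x \<otimes>\<^bsub>qmat_algebra q N\<^esub> y)"
    by (simp add: simps)
qed

end

section \<open>The quantum matrix algebras as a type\<close>

text \<open>
  The carrier of the quantum matrix algebra depends on \<open>q\<close> and \<open>N\<close>, so it is not a type. Families
  of elements, one for each \<open>q\<close> and \<open>N\<close>, do form a type, and a ring under componentwise operations.
  An identity in one algebra is the component of an identity between families concentrated there.
  The sort avoids \<open>ring_1\<close>, which would require all these algebras to be nontrivial.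
\<close>

typedef qmat_family = "{F. \<forall>q N. F q N \<in> carrier (qmat_algebra q N)}"
  by (intro exI[of _ "\<lambda>q N. \<zero>\<^bsub>qmat_algebra q N\<^esub>"]) (simp add: ring.ring_simprules(2)[OF ring_qmat_algebra])

setup_lifting type_definition_qmat_family

instantiation qmat_family :: "{ring, monoid_mult}"
begin

lift_definition zero_qmat_family :: qmat_family is "\<lambda>q N. \<zero>\<^bsub>qmat_algebra q N\<^esub>"
  by (intro ring.ring_simprules ring_qmat_algebra)

lift_definition one_qmat_family :: qmat_family is "\<lambda>q N. \<one>\<^bsub>qmat_algebra q N\<^esub>"
  by (intro ring.ring_simprules ring_qmat_algebra)

lift_definition plus_qmat_family :: "qmat_family \<Rightarrow> qmat_family \<Rightarrow> qmat_family"
  is "\<lambda>F G q N. F q N \<oplus>\<^bsub>qmat_algebra q N\<^esub> G q N"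
  by (intro ring.ring_simprules ring_qmat_algebra) simp_all

lift_definition times_qmat_family :: "qmat_family \<Rightarrow> qmat_family \<Rightarrow> qmat_family"
  is "\<lambda>F G q N. F q N \<otimes>\<^bsub>qmat_algebra q N\<^esub> G q N"
  by (intro ring.ring_simprules ring_qmat_algebra) simp_all

lift_definition uminus_qmat_family :: "qmat_family \<Rightarrow> qmat_family"
  is "\<lambda>F q N. \<ominus>\<^bsub>qmat_algebra q N\<^esub> F q N"
  by (intro ring.ring_simprules ring_qmat_algebra) simp_all

lift_definition minus_qmat_family :: "qmat_family \<Rightarrow> qmat_family \<Rightarrow> qmat_family"
  is "\<lambda>F G q N. F q N \<ominus>\<^bsub>qmat_algebra q N\<^esub> G q N"
  by (intro ring.ring_simprules ring_qmat_algebra) simp_all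

instance
  by standard
    (transfer, simp add: ring.ring_simprules[OF ring_qmat_algebra] ring.is_monoid[OF ring_qmat_algebra]
      monoid.r_one[OF ring.is_monoid[OF ring_qmat_algebra]])+

end

lift_definition scale_qmat_family :: "complex \<Rightarrow> qmat_family \<Rightarrow> qmat_family"
  is "\<lambda>c F q N. c \<odot>\<^bsub>qmat_algebra q N\<^esub> F q N"
  by (rule qmat_algebra_smult_closed) simp

lemma qmat_class_closed: "f \<in> qmat_words N \<Longrightarrow> qmat_class q N f \<in> carrier (qmat_algebra q N)"
  by (simp add: carrier_qmat_algebra)

text \<open>Putting 0 outside \<open>{1..N}\<close> makes the relations hold for all indices.\<close>

lift_definition entry_family :: "complex \<Rightarrow> nat \<Rightarrow> nat \<Rightarrow> nat \<Rightarrow> qmat_family"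
  is "\<lambda>q N i j q' N'. if q' = q \<and> N' = N \<and> i \<in> {1..N} \<and> j \<in> {1..N} then qmat_gen q N i j
    else \<zero>\<^bsub>qmat_algebra q' N'\<^esub>"
  using qmat_class_closed[OF free_gen_in_free_algebra]
  by (auto simp: ring.ring_simprules(2)[OF ring_qmat_algebra] qmat_gen_def qmat_class_def)

lemma qmat_gen_class: "qmat_gen q N i j = qmat_class q N (free_gen (i, j))"
  by (simp add: qmat_gen_def qmat_class_def)

context
  notes One_nat_def [simp del]
begin

text \<open>Each relator lies in the ideal, so its two sides have equal classes. The diagonal
  relation has a sum on the right because classes are computed for sums, products and scalar
  multiples.\<close>

lemma qmat_gen_relations:
  assumes "i \<in> {1..N}" "j \<in> {1..N}" "k \<in> {1..N}" "l \<in> {1..N}" "i < j"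
  shows "qmat_gen q N i k \<otimes>\<^bsub>qmat_algebra q N\<^esub> qmat_gen q N j k =
      q \<odot>\<^bsub>qmat_algebra q N\<^esub> (qmat_gen q N j k \<otimes>\<^bsub>qmat_algebra q N\<^esub> qmat_gen q N i k)"
    and "k < l \<Longrightarrow> qmat_gen q N j k \<otimes>\<^bsub>qmat_algebra q N\<^esub> qmat_gen q N i l =
      qmat_gen q N i l \<otimes>\<^bsub>qmat_algebra q N\<^esub> qmat_gen q N j k"
    and "k < l \<Longrightarrow> qmat_gen q N i k \<otimes>\<^bsub>qmat_algebra q N\<^esub> qmat_gen q N j l =
      qmat_gen q N j l \<otimes>\<^bsub>qmat_algebra q N\<^esub> qmat_gen q N i k \<oplus>\<^bsub>qmat_algebra q N\<^esub>
      (q - inverse q) \<odot>\<^bsub>qmat_algebra q N\<^esub> (qmat_gen q N i l \<otimes>\<^bsub>qmat_algebra q N\<^esub> qmat_gen q N j k)"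
proof -
  let ?a = "\<lambda>i j. free_gen (i, j) :: (nat \<times> nat) fword \<Rightarrow>\<^sub>0 complex"
  have gens: "?a x y \<in> qmat_words N" if "x \<in> {1..N}" "y \<in> {1..N}" for x y
    using that by (intro free_gen_in_free_algebra) auto
  note closed = gens[OF assms(1,3)] gens[OF assms(1,4)] gens[OF assms(2,3)] gens[OF assms(2,4)]
    free_algebra_mult free_algebra_add scalar_in_free_algebra
  note gen = ring.genideal_self[OF ring_free_algebra qmat_relators_subset, folded qmat_ideal_def, THEN subsetD]
  have "?a i k * ?a j k - Poly_Mapping.single 0 q * (?a j k * ?a i k) \<in> qmat_relators q N"
    unfolding qmat_relators_def Let_def using assms by blast
  from qmat_class_eqI[OF _ _ gen[OF this]]
  show "qmat_gen q N i k \<otimes>\<^bsub>qmat_algebra q N\<^esub> qmat_gen q N j k =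
      q \<odot>\<^bsub>qmat_algebra q N\<^esub> (qmat_gen q N j k \<otimes>\<^bsub>qmat_algebra q N\<^esub> qmat_gen q N i k)"
    by (simp add: qmat_gen_class qmat_class_ops closed)
  assume kl: "k < l"
  have "?a j k * ?a i l - ?a i l * ?a j k \<in> qmat_relators q N"
    unfolding qmat_relators_def Let_def using assms kl by blast
  from qmat_class_eqI[OF _ _ gen[OF this]]
  show "qmat_gen q N j k \<otimes>\<^bsub>qmat_algebra q N\<^esub> qmat_gen q N i l =
      qmat_gen q N i l \<otimes>\<^bsub>qmat_algebra q N\<^esub> qmat_gen q N j k"
    by (simp add: qmat_gen_class qmat_class_ops closed)
  have "?a i k * ?a j l - (?a j l * ?a i k + Poly_Mapping.single 0 (q - inverse q) * (?a i l * ?a j k))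
      \<in> qmat_relators q N"
    unfolding qmat_relators_def Let_def diff_diff_eq[symmetric] using assms kl by blast
  from qmat_class_eqI[OF _ _ gen[OF this]]
  show "qmat_gen q N i k \<otimes>\<^bsub>qmat_algebra q N\<^esub> qmat_gen q N j l =
      qmat_gen q N j l \<otimes>\<^bsub>qmat_algebra q N\<^esub> qmat_gen q N i k \<oplus>\<^bsub>qmat_algebra q N\<^esub>
      (q - inverse q) \<odot>\<^bsub>qmat_algebra q N\<^esub> (qmat_gen q N i l \<otimes>\<^bsub>qmat_algebra q N\<^esub> qmat_gen q N j k)"
    by (simp add: qmat_gen_class qmat_class_ops closed)
qed

end

lemma scale_qmat_family_laws:
  "scale_qmat_family c (x + y) = scale_qmat_family c x + scale_qmat_family c y"
  "scale_qmat_family (c + d) x = scale_qmat_family c x + scale_qmat_family d x"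
  "scale_qmat_family c (scale_qmat_family d x) = scale_qmat_family (c * d) x"
  "scale_qmat_family 1 x = x"
  "scale_qmat_family c x * y = scale_qmat_family c (x * y)"
  "x * scale_qmat_family c y = scale_qmat_family c (x * y)"
  by (transfer, simp add: qmat_algebra_smult qmat_algebra_smult_bilinear)+

interpretation qmat_family: vector_space scale_qmat_family
  by standard (simp_all add: scale_qmat_family_laws)

lemma Rep_entry_family:
  "Rep_qmat_family (entry_family q N i j) q' N' =
    (if q' = q \<and> N' = N \<and> i \<in> {1..N} \<and> j \<in> {1..N} then qmat_gen q N i j else \<zero>\<^bsub>qmat_algebra q' N'\<^esub>)"
  by transfer simp

lemma entry_family_outside:
  assumes "\<not> (i \<in> {1..N} \<and> j \<in> {1..N})"
  shows "entry_family q N i j = 0"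
  using assms by transfer auto

lemma qmat_family_eqI: "(\<And>q N. Rep_qmat_family x q N = Rep_qmat_family y q N) \<Longrightarrow> x = y"
  by (intro Rep_qmat_family_inject[THEN iffD1] ext)

lemmas Rep_ops = plus_qmat_family.rep_eq times_qmat_family.rep_eq minus_qmat_family.rep_eq
  zero_qmat_family.rep_eq one_qmat_family.rep_eq scale_qmat_family.rep_eq

lemma Rep_closed: "Rep_qmat_family x q N \<in> carrier (qmat_algebra q N)"
  using Rep_qmat_family by auto

lemma smult_zero: "c \<odot>\<^bsub>qmat_algebra q N\<^esub> \<zero>\<^bsub>qmat_algebra q N\<^esub> = \<zero>\<^bsub>qmat_algebra q N\<^esub>"
  using qmat_family.scale_zero_right[of c] by (metis Rep_ops(4,6))

text \<open>For indices in range, the component at \<open>q\<close>, \<open>N\<close> satisfies the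
  relations of the generators and all other components are zero. If an index is out of range, every
  product in the relation has a zero factor.\<close>

lemma quantum_matrix_entry_family:
  assumes "q \<noteq> 0"
  shows "quantum_matrix scale_qmat_family q (entry_family q N)"
proof
  let ?a = "entry_family q N"
  note ops = Rep_ops Rep_entry_family
  note zero = ring.ring_simprules(2,8,24,25)[OF ring_qmat_algebra] smult_zero
  show "?a i k * ?a j k = scale_qmat_family q (?a j k * ?a i k)" if "i < j" for i j k
  proof (cases "i \<in> {1..N} \<and> j \<in> {1..N} \<and> k \<in> {1..N}")
    case True
    show ?thesis
    proof (rule qmat_family_eqI)
      fix q' N' show "Rep_qmat_family (?a i k * ?a j k) q' N' =
          Rep_qmat_family (scale_qmat_family q (?a j k * ?a i k)) q' N'"
        using True that qmat_gen_relations(1)[of i N j k k q]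
        by (cases "q' = q"; cases "N' = N") (simp_all add: ops zero del: atLeastAtMost_iff)
    qed
  qed (auto simp: entry_family_outside)
  show "?a j k * ?a i l = ?a i l * ?a j k" if "i < j" "k < l" for i j k l
  proof (cases "i \<in> {1..N} \<and> j \<in> {1..N} \<and> k \<in> {1..N} \<and> l \<in> {1..N}")
    case True
    show ?thesis
    proof (rule qmat_family_eqI)
      fix q' N' show "Rep_qmat_family (?a j k * ?a i l) q' N' = Rep_qmat_family (?a i l * ?a j k) q' N'"
        using True that qmat_gen_relations(2)[of i N j k l q]
        by (cases "q' = q"; cases "N' = N") (simp_all add: ops zero del: atLeastAtMost_iff)
    qed
  qed (auto simp: entry_family_outside)
  show "?a i k * ?a j l - ?a j l * ?a i k = scale_qmat_family (q - inverse q) (?a i l * ?a j k)"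
    if "i < j" "k < l" for i j k l
  proof (cases "i \<in> {1..N} \<and> j \<in> {1..N} \<and> k \<in> {1..N} \<and> l \<in> {1..N}")
    case True
    have "?a i k * ?a j l = ?a j l * ?a i k + scale_qmat_family (q - inverse q) (?a i l * ?a j k)"
    proof (rule qmat_family_eqI)
      fix q' N' show "Rep_qmat_family (?a i k * ?a j l) q' N' =
          Rep_qmat_family (?a j l * ?a i k + scale_qmat_family (q - inverse q) (?a i l * ?a j k)) q' N'"
        using True that qmat_gen_relations(3)[of i N j k l q]
        by (cases "q' = q"; cases "N' = N") (simp_all add: ops zero del: atLeastAtMost_iff)
    qed
    then show ?thesis by simp
  qed (auto simp: entry_family_outside)
qed (simp_all add: scale_qmat_family_laws assms)

section \<open>Determinant and Pfaffian as components of families\<close>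

lemma Rep_sum:
  "finite A \<Longrightarrow> Rep_qmat_family (sum f A) q N = (\<Oplus>\<^bsub>qmat_algebra q N\<^esub>i\<in>A. Rep_qmat_family (f i) q N)"
proof (induction A rule: finite_induct)
  case empty
  interpret ring "qmat_algebra q N" by (rule ring_qmat_algebra)
  show ?case by (simp add: Rep_ops)
next
  case (insert x F)
  interpret ring "qmat_algebra q N" by (rule ring_qmat_algebra)
  show ?case using insert by (simp add: Rep_ops Rep_closed Pi_def)
qed

lemma Rep_prod_list:
  "Rep_qmat_family (prod_list xs) q N =
    foldr (\<lambda>x y. x \<otimes>\<^bsub>qmat_algebra q N\<^esub> y) (map (\<lambda>x. Rep_qmat_family x q N) xs) \<one>\<^bsub>qmat_algebra q N\<^esub>"
  by (induction xs) (simp_all add: Rep_ops)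

lemma finsum_qmat_cong:
  assumes "\<And>i. i \<in> A \<Longrightarrow> f i = g i" "\<And>i. i \<in> A \<Longrightarrow> g i \<in> carrier (qmat_algebra q N)"
  shows "(\<Oplus>\<^bsub>qmat_algebra q N\<^esub>i\<in>A. f i) = (\<Oplus>\<^bsub>qmat_algebra q N\<^esub>i\<in>A. g i)"
proof -
  interpret ring "qmat_algebra q N" by (rule ring_qmat_algebra)
  show ?thesis using assms by (intro finsum_cong') auto
qed

lemma pf_entry_b_eq_Rep:
  assumes "q \<noteq> 0" "i \<in> {1..N}" "j \<in> {1..N}" "2 * n \<le> N"
  shows "pf_entry_b (qmat_algebra q N) q n (qmat_gen q N) i j =
    Rep_qmat_family (quantum_matrix.block_entry scale_qmat_family q (entry_family q N) n i j) q N"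
proof -
  interpret quantum_matrix scale_qmat_family q "entry_family q N"
    by (rule quantum_matrix_entry_family[OF assms(1)])
  show ?thesis
    unfolding pf_entry_b_def block_entry_def Rep_sum[OF finite_atLeastAtMost]
  proof (rule finsum_qmat_cong)
    fix m assume "m \<in> {1..n}"
    \<comment> \<open>All columns involved are in range, so the families have the generators and not
      the default zero as components.\<close>
    then have "2 * m - 1 \<in> {1..N}" "2 * m \<in> {1..N}" using assms by auto
    then show "qmat_gen q N i (2 * m - 1) \<otimes>\<^bsub>qmat_algebra q N\<^esub> qmat_gen q N j (2 * m)
        \<ominus>\<^bsub>qmat_algebra q N\<^esub> (q \<odot>\<^bsub>qmat_algebra q N\<^esub>
          (qmat_gen q N j (2 * m - 1) \<otimes>\<^bsub>qmat_algebra q N\<^esub> qmat_gen q N i (2 * m))) =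
      Rep_qmat_family (entry_family q N i (2 * m - 1) * entry_family q N j (2 * m) -
        scale_qmat_family q (entry_family q N j (2 * m - 1) * entry_family q N i (2 * m))) q N"
      using assms by (simp only: Rep_ops Rep_entry_family simp_thms if_True)
  qed (rule Rep_closed)
qed

lemma quantum_det_eq_Rep:
  assumes "q \<noteq> 0"
  shows "quantum_det (qmat_algebra q N) q N (qmat_gen q N) =
    Rep_qmat_family (quantum_matrix.minor scale_qmat_family q (entry_family q N) [1..<Suc N] {1..N}) q N"
proof -
  interpret quantum_matrix scale_qmat_family q "entry_family q N"
    by (rule quantum_matrix_entry_family[OF assms])
  show ?thesis
    unfolding quantum_det_def minor_eq_det Rep_sum[OF finite_permutations[OF finite_atLeastAtMost]]
  proof (rule finsum_qmat_cong)
    fix \<sigma> assume "\<sigma> \<in> {\<sigma>. \<sigma> permutes {1..N}}"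
    then have "\<sigma> i \<in> {1..N}" if "i \<in> {1..N}" for i
      using that by (simp add: permutes_in_image del: atLeastAtMost_iff)
    then have "map (\<lambda>i. qmat_gen q N i (\<sigma> i)) [1..<N + 1] =
      map (\<lambda>x. Rep_qmat_family x q N) (map (\<lambda>i. entry_family q N i (\<sigma> i)) [1..<Suc N])"
      by (auto simp: Rep_entry_family simp del: upt_Suc)
    then show "(- q) ^ inversion_number N \<sigma> \<odot>\<^bsub>qmat_algebra q N\<^esub>
        foldr (\<lambda>x y. x \<otimes>\<^bsub>qmat_algebra q N\<^esub> y) (map (\<lambda>i. qmat_gen q N i (\<sigma> i)) [1..<N + 1])
          \<one>\<^bsub>qmat_algebra q N\<^esub> =
      Rep_qmat_family (scale_qmat_family ((- q) ^ inversion_number N \<sigma>)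
        (prod_list (map (\<lambda>i. entry_family q N i (\<sigma> i)) [1..<Suc N]))) q N"
      by (simp only: Rep_ops Rep_prod_list)
  qed (rule Rep_closed)
qed

text \<open>On an increasing list the recursion reaches only entries with \<open>i < j\<close>, so
  agreement of \<open>e\<close> and \<open>e'\<close> on these suffices.\<close>

lemma qpf_bracket_eq_Rep:
  assumes "q \<noteq> 0" "sorted_wrt (<) S" "length S = 2 * t"
    and "\<And>i j. i \<in> set S \<Longrightarrow> j \<in> set S \<Longrightarrow> i < j \<Longrightarrow> e i j = Rep_qmat_family (e' i j) q N"
  shows "qpf_bracket (qmat_algebra q N) q e t S =
    Rep_qmat_family (quantum_matrix.bracket scale_qmat_family q e' t S) q N"
proof -
  interpret quantum_matrix scale_qmat_family q "entry_family q N"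
    by (rule quantum_matrix_entry_family[OF assms(1)])
  show ?thesis
    using assms(2-)
  proof (induction t arbitrary: S)
    case 0
    then show ?case by (simp add: Rep_ops)
  next
    case (Suc t)
    have entry: "e (S ! 0) (S ! j) = Rep_qmat_family (e' (S ! 0) (S ! j)) q N" if "j \<in> {1..<length S}" for j
      using that Suc.prems(1) by (intro Suc.prems(3)) (auto simp: sorted_wrt_nth_less intro!: nth_mem)
    show ?case
    proof (cases "t = 0")
      case True
      \<comment> \<open>Here the two recursions differ in form: an entry against a one-term sum with
        coefficient 1 and the empty bracket.\<close>
      then have "{1..<length S} = {1}" using Suc.prems(2) by auto
      then show ?thesis using True entry[of 1] Suc.prems(2) by simp
    next
      case False
      have rest: "qpf_bracket (qmat_algebra q N) q e t (nths S (- {0, j})) =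
        Rep_qmat_family (bracket e' t (nths S (- {0, j}))) q N" if j: "j \<in> {1..<length S}" for j
      proof (rule Suc.IH)
        have "{i. i < length S \<and> i \<in> - {0, j}} = {..<length S} - {0, j}" by auto
        then show "length (nths S (- {0, j})) = 2 * t"
          using j Suc.prems(2) by (simp add: length_nths card_Diff_subset)
        show "sorted_wrt (<) (nths S (- {0, j}))"
          by (rule sorted_wrt_nths[OF Suc.prems(1)])
        show "e x y = Rep_qmat_family (e' x y) q N"
          if "x \<in> set (nths S (- {0, j}))" "y \<in> set (nths S (- {0, j}))" "x < y" for x y
          using that by (intro Suc.prems(3)) (auto dest: in_set_nthsD)
      qed
      show ?thesis
        unfolding qpf_bracket.simps bracket.simps Rep_sum[OF finite_atLeastLessThan] if_not_P[OF False]
      proof (rule finsum_qmat_cong)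
        fix j assume j: "j \<in> {1..<length S}"
        show "(- q) ^ (j - 1) \<odot>\<^bsub>qmat_algebra q N\<^esub> (e (S ! 0) (S ! j)
            \<otimes>\<^bsub>qmat_algebra q N\<^esub> qpf_bracket (qmat_algebra q N) q e t (nths S (- {0, j}))) =
          Rep_qmat_family (scale_qmat_family ((- q) ^ (j - 1))
            (e' (S ! 0) (S ! j) * bracket e' t (nths S (- {0, j})))) q N"
          by (simp only: Rep_ops entry[OF j] rest[OF j])
      qed (rule Rep_closed)
    qed
  qed
qed

theorem corollary2p15:
  fixes q :: complex and n :: nat
  assumes "q \<noteq> 0" and "n \<ge> 1"
  shows "quantum_det (qmat_algebra q (2 * n + 1)) q (2 * n + 1) (qmat_gen q (2 * n + 1)) =
    quantum_pfaffian (qmat_algebra q (2 * n + 1)) q (n + 1)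
      (\<lambda>i j. if j = 2 * n + 2 then qmat_gen q (2 * n + 1) i (2 * n + 1)
             else pf_entry_b (qmat_algebra q (2 * n + 1)) q n (qmat_gen q (2 * n + 1)) i j)"
proof -
  define N where "N = 2 * n + 1"
  interpret quantum_matrix scale_qmat_family q "entry_family q N"
    by (rule quantum_matrix_entry_family[OF assms(1)])
  let ?e = "\<lambda>i j. if j = 2 * n + 2 then qmat_gen q N i N
    else pf_entry_b (qmat_algebra q N) q n (qmat_gen q N) i j"
  let ?e' = "\<lambda>i j. if j = 2 * n + 2 then entry_family q N i N else block_entry n i j"
  have "quantum_pfaffian (qmat_algebra q N) q (n + 1) ?e =
    Rep_qmat_family (bracket ?e' (n + 1) [1..<2 * (n + 1) + 1]) q N"
    unfolding quantum_pfaffian_def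
  proof (rule qpf_bracket_eq_Rep[OF assms(1)])
    fix i j assume "i \<in> set [1..<2 * (n + 1) + 1]" "j \<in> set [1..<2 * (n + 1) + 1]" "i < j"
    \<comment> \<open>As \<open>i < j\<close>, the extra index \<open>2 * n + 2\<close> can occur
      only in second place.\<close>
    then have "i \<in> {1..N}" "j = 2 * n + 2 \<or> j \<in> {1..N}"
      by (auto simp: N_def)
    then show "?e i j = Rep_qmat_family (?e' i j) q N"
      using pf_entry_b_eq_Rep[OF assms(1), of i N j n] by (auto simp: Rep_entry_family N_def)
  qed (simp_all del: upt_Suc)
  moreover have "bracket ?e' (n + 1) [1..<2 * (n + 1) + 1] = minor [1..<2 * n + 2] {1..2 * n + 1}"
    by (rule bracket_eq_minor) (auto simp: N_def)
  moreover have "quantum_det (qmat_algebra q N) q N (qmat_gen q N) =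
      Rep_qmat_family (minor [1..<2 * n + 2] {1..2 * n + 1}) q N"
    using quantum_det_eq_Rep[OF assms(1), of N] by (simp add: N_def del: upt_Suc)
  ultimately have "quantum_det (qmat_algebra q N) q N (qmat_gen q N) = quantum_pfaffian (qmat_algebra q N) q (n + 1) ?e"
    by (simp only:)
  then show ?thesis unfolding N_def .
qed

end
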